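(* Let $\mathcal A\colon\Omega\times\mathbb N\to\mathcal L(X)$ be a linear cocycle over $\sigma$, with generator $A$, that admits a tempered exponential dichotomy. Then there exists a tempered random variable $c\colon\Omega\to(0,\infty)$ with the property that each compact cocycle $\mathcal B\colon\Omega\times\mathbb N\to\mathcal L(X)$ over $\sigma$ whose generator $B$ satisfies $$\|A(\omega)-B(\omega)\|\le c(\omega)\quad\text{for $\mathbb P$-a.e. }\omega\in\Omega$$ also admits a tempered exponential dichotomy.
   Context: Setting. $X$ is a separable Banach space, $\mathcal L(X)$ the space of bounded linear operators on $X$ with the operator norm. $(\Omega,\mathcal F,\mathbb P)$ is a probability space with $(\Omega,\mathcal F)$ a Polish space (with its Borel $\sigma$-algebra). $\sigma\colon\Omega\to\Omega$ is invertible, measurable with measurable inverse, preserves $\mathbb P$, $\mathbb P$ is ergodic for $\sigma$, and $\sigma$ is aperiodic (the set of periodic points is $\mathbb P$-null). $\mathbb N=\{0,1,2,\dots\}$. Cocycle. A map $\mathcal A\colon\Omega\times\mathbb N\to\mathcal L(X)$ is a (strongly measurable) linear cocycle if $\mathcal A(\omega,0)=\mathrm{Id}$; $\mathcal A(\omega,n+m)=\mathcal A(\sigma^m\omega,n)\mathcal A(\omega,m)$ for all $\omega\in\Omega$, $n,m\in\mathbb N$; and for each $x\in X$ the map $\omega\mapsto A(\omega)x$ is measurable, where $A(\omega):=\mathcal A(\omega,1)$ is the generator. It is compact if $A(\omega)$ is a compact operator for all $\omega\in\Omega$. Tempered. A random variable $K\colon\Omega\to(0,\infty)$ is tempered if $\lim_{n\to\pm\infty}\frac1n\log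 K(\sigma^n\omega)=0$ for $\mathbb P$-a.e. $\omega$. Tempered exponential dichotomy. $\mathcal A$ admits a tempered exponential dichotomy if there exist a $\sigma$-invariant set $\Omega'\subset\Omega$ of full measure, a tempered random variable $K\colon\Omega\to(0,\infty)$, $\lambda>0$ and a family of projections $\Pi^s(\omega)$ on $X$ such that for all $\omega\in\Omega'$ and $n\in\mathbb N$: $\Pi^s(\sigma\omega)A(\omega)=A(\omega)\Pi^s(\omega)$; $A(\omega)|_{\mathrm{Ker}\,\Pi^s(\omega)}\colon\mathrm{Ker}\,\Pi^s(\omega)\to\mathrm{Ker}\,\Pi^s(\sigma\omega)$ is invertible; $\|\mathcal A(\omega,n)\Pi^s(\omega)\|\le K(\omega)e^{-\lambda n}$; $\|\mathcal A(\omega,-n)(\mathrm{Id}-\Pi^s(\omega))\|\le K(\omega)e^{-\lambda n}$, where $\mathcal A(\omega,-n):=(\mathcal A(\sigma^{-n}\omega,n)|_{\mathrm{Ker}\,\Pi^s(\sigma^{-n}\omega)})^{-1}\colon\mathrm{Ker}\,\Pi^s(\omega)\to\mathrm{Ker}\,\Pi^s(\sigma^{-n}\omega)$; and for each $v\in X$, $\omega\mapsto\Pi^s(\omega)v$ is measurable. *)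

theory Defs
  imports "HOL-Probability.Probability"
begin

text \<open>
  A Polish space is modelled by the class \<^class>\<open>polish_space\<close>; the completely metrising distance
  that the class carries is never used, only the topology and its Borel sets.
\<close>

locale aperiodic_ergodic_system = prob_space M for M :: "'w::polish_space measure" +
  fixes \<sigma> :: "'w \<Rightarrow> 'w"
  assumes sets_borel: "sets M = sets borel"
    and bij_base: "bij \<sigma>"
    and measurable_base: "\<sigma> \<in> measurable M M"
    and measurable_base_inv: "inv \<sigma> \<in> measurable M M"
    and preserves: "distr M M \<sigma> = M"
    and ergodic: "\<And>E. E \<in> sets M \<Longrightarrow> \<sigma> -` E = E \<Longrightarrow> prob E = 0 \<or> prob E = 1"
    and aperiodic: "{\<omega>. \<exists>n\<ge>1. (\<sigma> ^^ n) \<omega> = \<omega>} \<in> null_sets M"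

definition tempered :: "'w measure \<Rightarrow> ('w \<Rightarrow> 'w) \<Rightarrow> ('w \<Rightarrow> real) \<Rightarrow> bool" where
  "tempered M \<sigma> K \<longleftrightarrow>
     K \<in> borel_measurable M \<and> (\<forall>\<omega>. K \<omega> > 0) \<and>
     (AE \<omega> in M. (\<lambda>n. 1 / real n * ln (K ((\<sigma> ^^ n) \<omega>))) \<longlonglongrightarrow> 0 \<and>
                 (\<lambda>n. 1 / (- real n) * ln (K ((inv \<sigma> ^^ n) \<omega>))) \<longlonglongrightarrow> 0)"

definition linear_cocycle ::
  "'w measure \<Rightarrow> ('w \<Rightarrow> 'w) \<Rightarrow> ('w \<Rightarrow> nat \<Rightarrow> ('a::real_normed_vector \<Rightarrow>\<^sub>L 'a)) \<Rightarrow> bool" where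
  "linear_cocycle M \<sigma> \<A> \<longleftrightarrow>
     (\<forall>\<omega>. \<A> \<omega> 0 = id_blinfun) \<and>
     (\<forall>\<omega> n m. \<A> \<omega> (n + m) = \<A> ((\<sigma> ^^ m) \<omega>) n o\<^sub>L \<A> \<omega> m) \<and>
     (\<forall>x. (\<lambda>\<omega>. blinfun_apply (\<A> \<omega> 1) x) \<in> borel_measurable M)"

definition compact_operator :: "('a::real_normed_vector \<Rightarrow>\<^sub>L 'b::real_normed_vector) \<Rightarrow> bool" where
  "compact_operator T \<longleftrightarrow> (\<forall>S. bounded S \<longrightarrow> compact (closure (blinfun_apply T ` S)))"

definition compact_cocycle :: "('w \<Rightarrow> nat \<Rightarrow> ('a::real_normed_vector \<Rightarrow>\<^sub>L 'a)) \<Rightarrow> bool" where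
  "compact_cocycle \<A> \<longleftrightarrow> (\<forall>\<omega>. compact_operator (\<A> \<omega> 1))"

definition Ker :: "('a::real_normed_vector \<Rightarrow>\<^sub>L 'b::real_normed_vector) \<Rightarrow> 'a set" where
  "Ker T = {x. blinfun_apply T x = 0}"

definition backward_cocycle ::
  "('w \<Rightarrow> 'w) \<Rightarrow> ('w \<Rightarrow> nat \<Rightarrow> ('a::real_normed_vector \<Rightarrow>\<^sub>L 'a)) \<Rightarrow> ('w \<Rightarrow> ('a \<Rightarrow>\<^sub>L 'a)) \<Rightarrow>
    'w \<Rightarrow> nat \<Rightarrow> 'a \<Rightarrow> 'a" where
  "backward_cocycle \<sigma> \<A> P \<omega> n =
     the_inv_into (Ker (P ((inv \<sigma> ^^ n) \<omega>))) (blinfun_apply (\<A> ((inv \<sigma> ^^ n) \<omega>) n))"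

text \<open>
  The kernels are closed, so on a Banach space the inverses below are bounded by the open mapping
  theorem; boundedness is stated only because \<^const>\<open>onorm\<close> is meaningless for unbounded maps.
\<close>

definition tempered_exponential_dichotomy ::
  "'w measure \<Rightarrow> ('w \<Rightarrow> 'w) \<Rightarrow> ('w \<Rightarrow> nat \<Rightarrow> ('a::real_normed_vector \<Rightarrow>\<^sub>L 'a)) \<Rightarrow> bool" where
  "tempered_exponential_dichotomy M \<sigma> \<A> \<longleftrightarrow>
     (\<exists>\<Omega>' K \<beta> P.
        \<Omega>' \<in> sets M \<and> measure M \<Omega>' = 1 \<and> \<sigma> -` \<Omega>' = \<Omega>' \<and>
        tempered M \<sigma> K \<and> \<beta> > 0 \<and>
        (\<forall>\<omega>. P \<omega> o\<^sub>L P \<omega> = P \<omega>) \<and>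
        (\<forall>v. (\<lambda>\<omega>. blinfun_apply (P \<omega>) v) \<in> borel_measurable M) \<and>
        (\<forall>\<omega>\<in>\<Omega>'.
           P (\<sigma> \<omega>) o\<^sub>L \<A> \<omega> 1 = \<A> \<omega> 1 o\<^sub>L P \<omega> \<and>
           bij_betw (blinfun_apply (\<A> \<omega> 1)) (Ker (P \<omega>)) (Ker (P (\<sigma> \<omega>))) \<and>
           (\<forall>n. norm (\<A> \<omega> n o\<^sub>L P \<omega>) \<le> K \<omega> * exp (- \<beta> * real n)) \<and>
           (\<forall>n. bounded_linear (\<lambda>x. backward_cocycle \<sigma> \<A> P \<omega> n (x - blinfun_apply (P \<omega>) x)) \<and>
                onorm (\<lambda>x. backward_cocycle \<sigma> \<A> P \<omega> n (x - blinfun_apply (P \<omega>) x))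
                  \<le> K \<omega> * exp (- \<beta> * real n))))"

end

theory Submission
  imports Defs
begin

text \<open>
  Fix an orbit and write \<open>A m\<close>, \<open>B m\<close>, \<open>K m\<close> for the generators and the tempered bound at the
  \<open>m\<close>-th point, \<open>m \<in> \<int>\<close>. The Green function of the unperturbed dichotomy decays like
  \<open>K n * exp (- \<beta> * \<bar>m - n\<bar>)\<close>, so if \<open>K (m + 1) * norm (A m - B m)\<close> is bounded by a small constant,
  i.e. \<open>c \<omega> = const / K (\<sigma> \<omega>)\<close>, a fixed-point iteration shows that
  \<open>x (m + 1) = B m (x m) + (if m + 1 = 0 then v else 0)\<close> has exactly one bounded solution on \<open>\<int>\<close>, and
  it decays like \<open>exp (- \<beta> / 2 * \<bar>m\<bar>)\<close>. Uniqueness is where temperedness enters.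
  The new projection sends \<open>v\<close> to \<open>x 0\<close>: by uniqueness its range consists of the vectors with bounded
  forward orbit and its kernel of those with a bounded backward orbit, which gives invariance,
  invertibility on the kernel and both estimates. It is strongly measurable as a pointwise limit of
  the iterates.
\<close>

section \<open>Dichotomies along a single orbit\<close>

text \<open>Sources are measured with the weight \<open>K n\<close>, solutions in the plain norm;
  this makes the Green operator bounded although \<open>K\<close> need not be bounded along an
  orbit. The estimates carry a further weight \<open>exp (- \<gamma> * \<bar>m\<bar>)\<close> with 0
  \<le> \<gamma> \<le> \<beta>/2. Taking \<gamma> = 0 gives contraction and uniqueness, taking
  \<gamma> = \<beta>/2 gives the decay of the new dichotomy. Staying at half the rate leaves the
  ratio \<open>exp (- \<beta> / 2)\<close> for summation: two such geometric series, one over the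
  past and one over the future, add up to \<open>green_const \<beta>\<close>. In the closeness
  constant \<open>exp (- \<beta> / 2) / (2 * green_const \<beta>)\<close> the exponential pays for
  the shift by one index between a solution and the source it generates, and the rest makes every
  iteration step halve the error. The obstacle to measurability is the backward evolution: it
  inverts operators that are only strongly measurable, between kernels that vary with the base
  point.\<close>

definition green_const :: "real \<Rightarrow> real" where
  "green_const \<beta> = 2 / (1 - exp (- \<beta> / 2))"

lemma green_const_pos: "\<beta> > 0 \<Longrightarrow> green_const \<beta> > 0"
  by (simp add: green_const_def)

text \<open>
  \<open>Phi m n\<close> leads from index \<open>m\<close> to \<open>m + n\<close>; \<open>V m n\<close> projects along \<open>P m\<close> onto its kernel and then
  goes back to index \<open>m - n\<close>.
\<close>

locale dichotomy_sequence =
  fixes A P :: "int \<Rightarrow> 'a::banach \<Rightarrow>\<^sub>L 'a"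
    and Phi :: "int \<Rightarrow> nat \<Rightarrow> 'a \<Rightarrow>\<^sub>L 'a"
    and V :: "int \<Rightarrow> nat \<Rightarrow> 'a \<Rightarrow> 'a"
    and K :: "int \<Rightarrow> real" and \<beta> :: real
  assumes beta_pos: "\<beta> > 0"
    and K_pos: "K m > 0"
    and Phi_0: "Phi m 0 = id_blinfun"
    and Phi_Suc: "Phi m (Suc n) = A (m + int n) o\<^sub>L Phi m n"
    and commute: "P (m + 1) (A m x) = A m (P m x)"
    and stable_bound: "norm (Phi m n (P m x)) \<le> K m * exp (- \<beta> * real n) * norm x"
    and V_0: "V m 0 x = x - P m x"
    and V_Suc: "A (m - 1 - int n) (V m (Suc n) x) = V m n x"
    and V_Phi: "V (m + int n) n (Phi m n x) = x - P m x"
    and unstable_bound: "norm (V m n x) \<le> K m * exp (- \<beta> * real n) * norm x"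
    and tempered_backward: "(\<lambda>n. K (m - int n) * exp (- \<beta> * real n)) \<longlonglongrightarrow> 0"
    and tempered_forward: "(\<lambda>n. K (m + int n) * exp (- \<beta> * real n)) \<longlonglongrightarrow> 0"
begin

text \<open>The Green operator: stable components of the source are carried forward from the past,
  kernel components are carried back from the future with a minus sign. The second sum starts at
  distance one, so the source at \<open>m\<close> itself enters only through its stable
  component.\<close>

definition sol :: "(int \<Rightarrow> 'a) \<Rightarrow> int \<Rightarrow> 'a" where
  "sol g m = (\<Sum>j. Phi (m - int j) j (P (m - int j) (g (m - int j))))
     - (\<Sum>j. V (m + int j + 1) (Suc j) (g (m + int j + 1)))"

abbreviation C :: real where "C \<equiv> green_const \<beta>"

lemma C_pos: "C > 0"
  using beta_pos by (rule green_const_pos)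

text \<open>By the triangle inequality, moving the weight from \<open>n\<close> to \<open>m\<close>
  costs at most \<open>exp (\<gamma> * j)\<close>. Since \<gamma> \<le> \<beta>/2, half of the decay
  rate survives as a summable power.\<close>

lemma weight_le:
  assumes "0 \<le> \<gamma>" "\<gamma> \<le> \<beta> / 2" "\<bar>m - n\<bar> = int j"
  shows "exp (- \<gamma> * \<bar>real_of_int n\<bar>) * exp (- \<beta> * real j) \<le> exp (- \<gamma> * \<bar>real_of_int m\<bar>) * exp (- \<beta> / 2) ^ j"
proof -
  have "\<bar>real_of_int m\<bar> \<le> \<bar>real_of_int n\<bar> + real j"
    using assms(3) by linarith
  then have "\<gamma> * \<bar>real_of_int m\<bar> \<le> \<gamma> * (\<bar>real_of_int n\<bar> + real j)"
    using assms(1) by (rule mult_left_mono)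
  moreover have "\<gamma> * real j \<le> \<beta> / 2 * real j"
    using assms(2) by (intro mult_right_mono) auto
  ultimately have "- \<gamma> * \<bar>real_of_int n\<bar> + - \<beta> * real j \<le> - \<gamma> * \<bar>real_of_int m\<bar> + real j * (- \<beta> / 2)"
    by (simp add: algebra_simps)
  then show ?thesis
    by (simp only: exp_add[symmetric] exp_of_nat_mult[symmetric] exp_le_cancel_iff)
qed

section \<open>Weighted bounds and recurrence for the Green operator\<close>

context
  fixes g :: "int \<Rightarrow> 'a" and b \<gamma> :: real
  assumes \<gamma>: "0 \<le> \<gamma>" "\<gamma> \<le> \<beta> / 2"
    and g: "\<And>n. K n * norm (g n) \<le> b * exp (- \<gamma> * \<bar>real_of_int n\<bar>)"
begin

lemma g_bound_nonneg: "b \<ge> 0"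
proof -
  have "0 \<le> K 0 * norm (g 0)" using K_pos[of 0] by simp
  with g[of 0] show ?thesis by simp
qed

lemma weighted_term_le:
  assumes "\<bar>m - n\<bar> = int j"
    and "norm y \<le> K n * exp (- \<beta> * real j) * norm (g n)"
  shows "norm y \<le> b * exp (- \<gamma> * \<bar>real_of_int m\<bar>) * exp (- \<beta> / 2) ^ j"
proof -
  have "norm y \<le> (K n * norm (g n)) * exp (- \<beta> * real j)"
    using assms(2) by (simp add: mult_ac)
  also have "\<dots> \<le> b * exp (- \<gamma> * \<bar>real_of_int n\<bar>) * exp (- \<beta> * real j)"
    by (intro mult_right_mono g) auto
  also have "\<dots> \<le> b * (exp (- \<gamma> * \<bar>real_of_int m\<bar>) * exp (- \<beta> / 2) ^ j)"
    unfolding mult.assoc by (intro mult_left_mono weight_le \<gamma> assms g_bound_nonneg)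
  finally show ?thesis by (simp add: mult_ac)
qed

lemma stable_term_le:
  "norm (Phi (m - int j) j (P (m - int j) (g (m - int j))))
     \<le> b * exp (- \<gamma> * \<bar>real_of_int m\<bar>) * exp (- \<beta> / 2) ^ j"
  by (rule weighted_term_le[where n = "m - int j"]) (simp, rule stable_bound)

lemma unstable_term_le:
  "norm (V (m + int j + 1) (Suc j) (g (m + int j + 1)))
     \<le> b * exp (- \<gamma> * \<bar>real_of_int m\<bar>) * exp (- \<beta> / 2) ^ j"
proof -
  have "norm (V (m + int j + 1) (Suc j) (g (m + int j + 1)))
     \<le> b * exp (- \<gamma> * \<bar>real_of_int m\<bar>) * exp (- \<beta> / 2) ^ (Suc j)"
    by (rule weighted_term_le[where n = "m + int j + 1"]) (simp, rule unstable_bound)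
  \<comment> \<open>One spare power is given up so that both sums share the same majorant.\<close>
  also have "\<dots> \<le> b * exp (- \<gamma> * \<bar>real_of_int m\<bar>) * exp (- \<beta> / 2) ^ j"
    using beta_pos by (intro mult_left_mono power_decreasing mult_nonneg_nonneg g_bound_nonneg) auto
  finally show ?thesis .
qed

lemma summable_weight: "summable (\<lambda>j. b * exp (- \<gamma> * \<bar>real_of_int m\<bar>) * exp (- \<beta> / 2) ^ j)"
  using beta_pos by (intro summable_mult summable_geometric) simp

lemma summable_stable: "summable (\<lambda>j. Phi (m - int j) j (P (m - int j) (g (m - int j))))"
  by (rule summable_comparison_test[OF _ summable_weight]) (use stable_term_le in blast)

lemma summable_unstable: "summable (\<lambda>j. V (m + int j + 1) (Suc j) (g (m + int j + 1)))"
  by (rule summable_comparison_test[OF _ summable_weight]) (use unstable_term_le in blast)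

lemma norm_sol_le: "norm (sol g m) \<le> C * b * exp (- \<gamma> * \<bar>real_of_int m\<bar>)"
proof -
  let ?w = "b * exp (- \<gamma> * \<bar>real_of_int m\<bar>)"
  have s: "(\<Sum>j. ?w * exp (- \<beta> / 2) ^ j) = ?w * (1 / (1 - exp (- \<beta> / 2)))"
    using beta_pos by (subst suminf_mult) (auto intro!: summable_geometric simp: suminf_geometric)
  have "norm (sol g m) \<le> ?w * (1 / (1 - exp (- \<beta> / 2))) + ?w * (1 / (1 - exp (- \<beta> / 2)))"
    unfolding sol_def s[symmetric]
    by (intro order.trans[OF norm_triangle_ineq4] add_mono
        norm_suminf_le stable_term_le unstable_term_le summable_weight)
  then show ?thesis by (simp add: green_const_def mult_ac)
qed

text \<open>Applying \<open>A m\<close> shifts the index in both sums. The stable sum at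
  \<open>m + 1\<close> has the extra head \<open>P (m + 1) (g (m + 1))\<close>, the unstable sum at
  \<open>m\<close> loses its head to the complementary component, and the two pieces recombine to
  \<open>g (m + 1)\<close>.\<close>

lemma sol_recurrence: "sol g (m + 1) = A m (sol g m) + g (m + 1)"
proof -
  let ?s = "\<lambda>m j. Phi (m - int j) j (P (m - int j) (g (m - int j)))"
  let ?u = "\<lambda>m j. V (m + int j + 1) (Suc j) (g (m + int j + 1))"
  have "?s (m + 1) (Suc j) = A m (?s m j)" for j
    using Phi_Suc[of "m - int j" j] by simp
  then have "(\<Sum>j. ?s (m + 1) j) = P (m + 1) (g (m + 1)) + (\<Sum>j. A m (?s m j))"
    using suminf_split_head[OF summable_stable[of "m + 1"]] by (simp add: Phi_0)
  also have "(\<Sum>j. A m (?s m j)) = A m (\<Sum>j. ?s m j)"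
    by (rule bounded_linear.suminf[OF blinfun.bounded_linear_right summable_stable, symmetric])
  finally have 1: "(\<Sum>j. ?s (m + 1) j) = P (m + 1) (g (m + 1)) + A m (\<Sum>j. ?s m j)" .
  have e: "A m (?u m j) = V (m + int j + 1) j (g (m + int j + 1))" for j
    using V_Suc[of "m + int j + 1" j "g (m + int j + 1)"] by simp
  have "A m (\<Sum>j. ?u m j) = (\<Sum>j. A m (?u m j))"
    by (rule bounded_linear.suminf[OF blinfun.bounded_linear_right summable_unstable])
  also have "\<dots> = A m (?u m 0) + (\<Sum>j. A m (?u m (Suc j)))"
    using suminf_split_head[OF bounded_linear.summable[OF blinfun.bounded_linear_right summable_unstable], of "A m" m]
    by simp
  also have "(\<Sum>j. A m (?u m (Suc j))) = (\<Sum>j. ?u (m + 1) j)"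
    unfolding e by (simp add: add_ac)
  also have "A m (?u m 0) = g (m + 1) - P (m + 1) (g (m + 1))"
    unfolding e by (simp add: V_0)
  finally have 2: "A m (\<Sum>j. ?u m j) = g (m + 1) - P (m + 1) (g (m + 1)) + (\<Sum>j. ?u (m + 1) j)" .
  show ?thesis unfolding sol_def blinfun.diff_right 1 2 by simp
qed

end

section \<open>Uniqueness of bounded orbits and bounded solutions\<close>

lemma orbit_eq_Phi:
  assumes "\<And>m. z (m + 1) = A m (z m)"
  shows "z (m + int n) = Phi m n (z m)"
proof (induction n)
  case (Suc n)
  then show ?case using assms[of "m + int n"] by (simp add: Phi_Suc add_ac)
qed (simp add: Phi_0)

lemma commute_Phi: "P (m + int n) (Phi m n x) = Phi m n (P m x)"
proof (induction n)
  case (Suc n)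
  then show ?case using commute[of "m + int n"] by (simp add: Phi_Suc add_ac)
qed (simp add: Phi_0)

text \<open>The stable component of \<open>z m\<close> is transported from index
  \<open>m - n\<close>, the other one is pulled back from \<open>m + n\<close>. Boundedness of
  \<open>z\<close> and temperedness make both bounds tend to 0 as \<open>n\<close> grows.\<close>

lemma bounded_orbit_zero:
  assumes rec: "\<And>m. z (m + 1) = A m (z m)" and b: "\<And>m. norm (z m) \<le> b"
  shows "z m = 0"
proof -
  have 1: "norm (P m (z m)) \<le> K (m - int n) * exp (- \<beta> * real n) * b" for n
  proof -
    have "P m (z m) = Phi (m - int n) n (P (m - int n) (z (m - int n)))"
      using commute_Phi[of "m - int n" n "z (m - int n)"] orbit_eq_Phi[OF rec, of "m - int n" n] by simp
    also have "norm \<dots> \<le> K (m - int n) * exp (- \<beta> * real n) * norm (z (m - int n))"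
      by (rule stable_bound)
    also have "\<dots> \<le> K (m - int n) * exp (- \<beta> * real n) * b"
      by (intro mult_left_mono b) (simp add: K_pos less_imp_le)
    finally show ?thesis .
  qed
  have "(\<lambda>n. K (m - int n) * exp (- \<beta> * real n) * b) \<longlonglongrightarrow> 0 * b"
    by (intro tendsto_mult tempered_backward tendsto_const)
  from LIMSEQ_le_const[OF this, of "norm (P m (z m))"] 1 have s: "norm (P m (z m)) \<le> 0" by auto
  have 2: "norm (z m - P m (z m)) \<le> K (m + int n) * exp (- \<beta> * real n) * b" for n
  proof -
    have "z m - P m (z m) = V (m + int n) n (z (m + int n))"
      unfolding orbit_eq_Phi[OF rec] V_Phi ..
    also have "norm \<dots> \<le> K (m + int n) * exp (- \<beta> * real n) * norm (z (m + int n))"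
      by (rule unstable_bound)
    also have "\<dots> \<le> K (m + int n) * exp (- \<beta> * real n) * b"
      by (intro mult_left_mono b) (simp add: K_pos less_imp_le)
    finally show ?thesis .
  qed
  have "(\<lambda>n. K (m + int n) * exp (- \<beta> * real n) * b) \<longlonglongrightarrow> 0 * b"
    by (intro tendsto_mult tempered_forward tendsto_const)
  from LIMSEQ_le_const[OF this, of "norm (z m - P m (z m))"] 2 have "norm (z m - P m (z m)) \<le> 0" by auto
  with s show ?thesis by simp
qed

text \<open>The difference from \<open>sol g\<close> is a bounded orbit of \<open>A\<close>, hence
  zero. The crude bound \<open>b'\<close> serves only this identification and does not reach the
  conclusion, so the estimate can be applied repeatedly to improve a bound.\<close>

lemma bounded_solution_le:
  assumes rec: "\<And>m. x (m + 1) = A m (x m) + g (m + 1)" and b: "\<And>m. norm (x m) \<le> b'"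
    and \<gamma>: "0 \<le> \<gamma>" "\<gamma> \<le> \<beta> / 2"
    and g: "\<And>n. K n * norm (g n) \<le> b * exp (- \<gamma> * \<bar>real_of_int n\<bar>)"
  shows "norm (x m) \<le> C * b * exp (- \<gamma> * \<bar>real_of_int m\<bar>)"
proof -
  have b0: "b \<ge> 0" by (rule g_bound_nonneg[OF \<gamma> g])
  have "norm (sol g m) \<le> C * b" for m
  proof -
    have "norm (sol g m) \<le> C * b * exp (- \<gamma> * \<bar>real_of_int m\<bar>)" by (rule norm_sol_le[OF \<gamma> g])
    also have "\<dots> \<le> C * b * 1" using b0 C_pos \<gamma>(1) by (intro mult_left_mono) auto
    finally show ?thesis by simp
  qed
  then have bd: "norm (x m - sol g m) \<le> b' + C * b" for m
    by (intro order.trans[OF norm_triangle_ineq4] add_mono b)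
  have "x m - sol g m = 0"
    by (rule bounded_orbit_zero[OF _ bd])
      (simp add: rec sol_recurrence[OF \<gamma> g] blinfun.diff_right)
  with norm_sol_le[OF \<gamma> g, of m] show ?thesis by simp
qed

end

section \<open>Perturbed sequences and their fixed-point iteration\<close>

locale perturbed_dichotomy_sequence = dichotomy_sequence +
  fixes B :: "int \<Rightarrow> 'a \<Rightarrow>\<^sub>L 'a"
  assumes perturbation: "K (m + 1) * norm (A m - B m) \<le> exp (- \<beta> / 2) / (2 * C)"
begin

text \<open>The factor \<open>exp (- \<beta> / 2)\<close> in \<open>perturbation\<close> absorbs the
  change of weight from \<open>n - 1\<close> to \<open>n\<close>; the remaining
  \<open>1 / (2 * C)\<close> turns the factor \<open>C\<close> of the Green operator into
  1/2.\<close>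

lemma perturbation_le:
  assumes \<gamma>: "0 \<le> \<gamma>" "\<gamma> \<le> \<beta> / 2"
    and y: "\<And>n. norm (y n) \<le> b * exp (- \<gamma> * \<bar>real_of_int n\<bar>)"
  shows "K n * norm ((B (n - 1) - A (n - 1)) (y (n - 1)))
     \<le> b / (2 * C) * exp (- \<gamma> * \<bar>real_of_int n\<bar>)"
proof -
  let ?d = "norm (A (n - 1) - B (n - 1))"
  have "0 \<le> norm (y 0)" by simp
  also have "\<dots> \<le> b" using y[of 0] by simp
  finally have b0: "0 \<le> b" .
  have "\<bar>real_of_int n\<bar> \<le> \<bar>real_of_int (n - 1)\<bar> + 1" by linarith
  then have "\<gamma> * \<bar>real_of_int n\<bar> \<le> \<gamma> * \<bar>real_of_int (n - 1)\<bar> + \<gamma>"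
    using mult_left_mono[OF _ \<gamma>(1)] by (fastforce simp: algebra_simps)
  then have e: "exp (- \<beta> / 2) * exp (- \<gamma> * \<bar>real_of_int (n - 1)\<bar>) \<le> exp (- \<gamma> * \<bar>real_of_int n\<bar>)"
    using \<gamma>(2) by (simp add: exp_add[symmetric])
  have "norm ((B (n - 1) - A (n - 1)) (y (n - 1))) \<le> ?d * norm (y (n - 1))"
    by (metis norm_blinfun norm_minus_commute)
  also have "\<dots> \<le> ?d * (b * exp (- \<gamma> * \<bar>real_of_int (n - 1)\<bar>))"
    by (intro mult_left_mono y) auto
  finally have "K n * norm ((B (n - 1) - A (n - 1)) (y (n - 1)))
      \<le> K n * (?d * (b * exp (- \<gamma> * \<bar>real_of_int (n - 1)\<bar>)))"
    by (intro mult_left_mono) (auto simp: K_pos less_imp_le)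
  also have "\<dots> = (K n * ?d) * (b * exp (- \<gamma> * \<bar>real_of_int (n - 1)\<bar>))" by (simp add: mult_ac)
  also have "\<dots> \<le> exp (- \<beta> / 2) / (2 * C) * (b * exp (- \<gamma> * \<bar>real_of_int (n - 1)\<bar>))"
    using perturbation[of "n - 1"] b0 by (intro mult_right_mono) auto
  also have "\<dots> = b / (2 * C) * (exp (- \<beta> / 2) * exp (- \<gamma> * \<bar>real_of_int (n - 1)\<bar>))"
    by simp
  also have "\<dots> \<le> b / (2 * C) * exp (- \<gamma> * \<bar>real_of_int n\<bar>)"
    using b0 C_pos by (intro mult_left_mono e) auto
  finally show ?thesis .
qed

text \<open>An orbit of \<open>B\<close> is a solution for \<open>A\<close> whose source is
  \<open>B - A\<close> applied to the orbit itself. Each application of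
  \<open>bounded_solution_le\<close> with \<gamma> = 0 therefore halves the uniform bound.\<close>

lemma perturbed_bounded_orbit_zero:
  assumes rec: "\<And>m. y (m + 1) = B m (y m)" and b: "\<And>m. norm (y m) \<le> b"
  shows "y m = 0"
proof -
  have step: "\<forall>m. norm (y m) \<le> b / 2 ^ j" for j
  proof (induction j)
    case (Suc j)
    have "norm (y m) \<le> C * (b / 2 ^ j / (2 * C)) * exp (- 0 * \<bar>real_of_int m\<bar>)" for m
    proof (rule bounded_solution_le[where g = "\<lambda>n. (B (n - 1) - A (n - 1)) (y (n - 1))"])
      show "y (m + 1) = A m (y m) + (B (m + 1 - 1) - A (m + 1 - 1)) (y (m + 1 - 1))" for m
        by (simp add: rec blinfun.diff_left)
      show "K n * norm ((B (n - 1) - A (n - 1)) (y (n - 1)))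
          \<le> b / 2 ^ j / (2 * C) * exp (- 0 * \<bar>real_of_int n\<bar>)" for n
        by (rule perturbation_le) (use Suc beta_pos in auto)
    qed (use b beta_pos in auto)
    then show ?case using C_pos by (simp add: mult.commute)
  qed (simp add: b)
  have "(\<lambda>j. b * (1 / 2) ^ j) \<longlonglongrightarrow> b * 0"
    by (intro tendsto_mult tendsto_const LIMSEQ_power_zero) simp
  from LIMSEQ_le_const[OF this, of "norm (y m)"] step have "norm (y m) \<le> 0"
    by (auto simp: power_divide)
  then show ?thesis by simp
qed

text \<open>Picard iteration for the bounded solution of the perturbed equation with jump
  \<open>v\<close> at index 0. The source at \<open>n\<close> reads the previous iterate at
  \<open>n - 1\<close> because in the recurrence \<open>g (m + 1)\<close> accompanies
  \<open>A m\<close>.\<close>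

primrec iter :: "'a \<Rightarrow> nat \<Rightarrow> int \<Rightarrow> 'a" where
  "iter v 0 = (\<lambda>m. 0)"
| "iter v (Suc j) = sol (\<lambda>n. (B (n - 1) - A (n - 1)) (iter v j (n - 1)) + (if n = 0 then v else 0))"

text \<open>This is why the ball of radius \<open>2 * C * K 0 * norm v\<close> is invariant: the
  perturbation and the jump at 0 each contribute \<open>K 0 * norm v\<close>, and the Green operator
  multiplies the sum by \<open>C\<close>.\<close>

lemma iter_source_le:
  assumes "\<And>n. norm (iter v j n) \<le> 2 * C * K 0 * norm v * exp (- (\<beta> / 2) * \<bar>real_of_int n\<bar>)"
  shows "K n * norm ((B (n - 1) - A (n - 1)) (iter v j (n - 1)) + (if n = 0 then v else 0))
     \<le> 2 * K 0 * norm v * exp (- (\<beta> / 2) * \<bar>real_of_int n\<bar>)"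
proof -
  have "K n * norm ((B (n - 1) - A (n - 1)) (iter v j (n - 1)) + (if n = 0 then v else 0))
     \<le> K n * norm ((B (n - 1) - A (n - 1)) (iter v j (n - 1))) + K n * norm (if n = 0 then v else 0)"
    unfolding distrib_left[symmetric]
    by (intro mult_left_mono norm_triangle_ineq) (simp add: K_pos less_imp_le)
  also have "\<dots> \<le> 2 * C * K 0 * norm v / (2 * C) * exp (- (\<beta> / 2) * \<bar>real_of_int n\<bar>)
      + K 0 * norm v * exp (- (\<beta> / 2) * \<bar>real_of_int n\<bar>)"
    using K_pos[of 0] beta_pos assms by (intro add_mono perturbation_le) auto
  also have "\<dots> = 2 * K 0 * norm v * exp (- (\<beta> / 2) * \<bar>real_of_int n\<bar>)"
    using C_pos by (simp add: field_simps)
  finally show ?thesis .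
qed

lemma norm_iter_le:
  "norm (iter v j m) \<le> 2 * C * K 0 * norm v * exp (- (\<beta> / 2) * \<bar>real_of_int m\<bar>)"
proof (induction j arbitrary: m)
  case 0
  show ?case using C_pos K_pos[of 0] by simp
next
  case (Suc j)
  have "norm (iter v (Suc j) m) \<le> C * (2 * K 0 * norm v) * exp (- (\<beta> / 2) * \<bar>real_of_int m\<bar>)"
    unfolding iter.simps by (rule norm_sol_le[OF _ _ iter_source_le]) (use Suc beta_pos in auto)
  then show ?case by (simp add: mult_ac)
qed

lemma norm_iter_le_const: "norm (iter v j m) \<le> 2 * C * K 0 * norm v"
proof -
  note norm_iter_le[of v j m]
  also have "2 * C * K 0 * norm v * exp (- (\<beta> / 2) * \<bar>real_of_int m\<bar>) \<le> 2 * C * K 0 * norm v * 1"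
    using C_pos K_pos[of 0] beta_pos by (intro mult_left_mono) auto
  finally show ?thesis by simp
qed

lemma iter_recurrence:
  "iter v (Suc j) (m + 1) = A m (iter v (Suc j) m) + (B m - A m) (iter v j m) + (if m + 1 = 0 then v else 0)"
  unfolding iter.simps
  by (subst sol_recurrence[OF _ _ iter_source_le[OF norm_iter_le]]) (use beta_pos in auto)

text \<open>The jump cancels in a difference of consecutive iterates, which is then driven by the
  previous difference alone; \<gamma> = 0 suffices here.\<close>

lemma norm_iter_diff_le:
  "norm (iter v (Suc j) m - iter v j m) \<le> 2 * C * K 0 * norm v / 2 ^ j"
proof (induction j arbitrary: m)
  case 0
  show ?case using norm_iter_le_const[of v 1 m] by simp
next
  case (Suc j)
  let ?b = "2 * C * K 0 * norm v / 2 ^ j"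
  let ?d = "\<lambda>m. iter v (Suc j) m - iter v j m"
  have "norm (iter v (Suc (Suc j)) m - iter v (Suc j) m) \<le> C * (?b / (2 * C)) * exp (- 0 * \<bar>real_of_int m\<bar>)"
  proof (rule bounded_solution_le[where g = "\<lambda>n. (B (n - 1) - A (n - 1)) (?d (n - 1))"])
    show "iter v (Suc (Suc j)) (m + 1) - iter v (Suc j) (m + 1) =
        A m (iter v (Suc (Suc j)) m - iter v (Suc j) m) + (B (m + 1 - 1) - A (m + 1 - 1)) (?d (m + 1 - 1))" for m
      unfolding iter_recurrence by (simp add: blinfun.diff_left blinfun.diff_right)
    show "norm (iter v (Suc (Suc j)) m - iter v (Suc j) m) \<le> 2 * C * K 0 * norm v + 2 * C * K 0 * norm v" for m
      by (intro order.trans[OF norm_triangle_ineq4] add_mono norm_iter_le_const)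
    show "K n * norm ((B (n - 1) - A (n - 1)) (?d (n - 1)))
        \<le> ?b / (2 * C) * exp (- 0 * \<bar>real_of_int n\<bar>)" for n
      by (rule perturbation_le) (use Suc beta_pos in auto)
  qed (use beta_pos in auto)
  also have "\<dots> = 2 * C * K 0 * norm v / 2 ^ Suc j" using C_pos by simp
  finally show ?case .
qed

text \<open>The Green function of the perturbed sequence with source at index 0. Its value at
  \<open>m = 0\<close> becomes the new projection applied to \<open>v\<close>.\<close>

definition response :: "'a \<Rightarrow> int \<Rightarrow> 'a" where
  "response v m = lim (\<lambda>j. iter v j m)"

lemma iter_tendsto: "(\<lambda>j. iter v j m) \<longlonglongrightarrow> response v m"
proof -
  have "summable (\<lambda>j. 2 * C * K 0 * norm v * (1 / 2) ^ j)"
    by (intro summable_mult summable_geometric) simp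
  then have "summable (\<lambda>j. iter v (Suc j) m - iter v j m)"
    by (rule summable_comparison_test[rotated])
      (use norm_iter_diff_le in \<open>auto simp: power_divide simp del: iter.simps(2)\<close>)
  then have "convergent (\<lambda>j. \<Sum>i<j. iter v (Suc i) m - iter v i m)"
    by (simp add: summable_iff_convergent del: iter.simps(2))
  moreover have "(\<Sum>i<j. iter v (Suc i) m - iter v i m) = iter v j m" for j
    using sum_lessThan_telescope[of "\<lambda>i. iter v i m" j] by simp
  ultimately show ?thesis
    unfolding response_def by (simp add: convergent_LIMSEQ_iff)
qed

lemma norm_response_le:
  "norm (response v m) \<le> 2 * C * K 0 * norm v * exp (- (\<beta> / 2) * \<bar>real_of_int m\<bar>)"
  by (rule LIMSEQ_le_const2[OF tendsto_norm[OF iter_tendsto]]) (use norm_iter_le in auto)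

lemma norm_response_le_const: "norm (response v m) \<le> 2 * C * K 0 * norm v"
  by (rule LIMSEQ_le_const2[OF tendsto_norm[OF iter_tendsto]]) (use norm_iter_le_const in auto)

text \<open>Iterate \<open>j + 1\<close> is moved by \<open>A\<close> and iterate \<open>j\<close>
  enters through \<open>B - A\<close>; both have the same limit, so the two contributions of
  \<open>A\<close> cancel.\<close>

lemma response_recurrence: "response v (m + 1) = B m (response v m) + (if m + 1 = 0 then v else 0)"
proof (rule LIMSEQ_unique)
  show "(\<lambda>j. iter v (Suc j) (m + 1)) \<longlonglongrightarrow> response v (m + 1)"
    by (rule LIMSEQ_Suc[OF iter_tendsto])
  have "(\<lambda>j. A m (iter v (Suc j) m) + (B m - A m) (iter v j m) + (if m + 1 = 0 then v else 0))
      \<longlonglongrightarrow> A m (response v m) + (B m - A m) (response v m) + (if m + 1 = 0 then v else 0)"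
    by (intro tendsto_intros iter_tendsto LIMSEQ_Suc[OF iter_tendsto])
  then show "(\<lambda>j. iter v (Suc j) (m + 1)) \<longlonglongrightarrow> B m (response v m) + (if m + 1 = 0 then v else 0)"
    unfolding iter_recurrence by (simp add: blinfun.diff_left)
qed

lemma response_unique:
  assumes rec: "\<And>m. x (m + 1) = B m (x m) + (if m + 1 = 0 then v else 0)"
    and b: "\<And>m. norm (x m) \<le> b"
  shows "x m = response v m"
proof -
  have "x m - response v m = 0"
  proof (rule perturbed_bounded_orbit_zero)
    show "x (m + 1) - response v (m + 1) = B m (x m - response v m)" for m
      unfolding rec response_recurrence by (simp add: blinfun.diff_right)
    show "norm (x m - response v m) \<le> b + 2 * C * K 0 * norm v" for m
      by (intro order.trans[OF norm_triangle_ineq4] add_mono norm_response_le_const b)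
  qed
  then show ?thesis by simp
qed

text \<open>Linearity follows from uniqueness, since sums and multiples of responses are bounded
  solutions with the corresponding jumps.\<close>

lemma bounded_linear_response: "bounded_linear (\<lambda>v. response v m)"
proof (rule bounded_linear_intro)
  fix v w :: 'a and r :: real
  show "response (v + w) m = response v m + response w m"
  proof (rule response_unique[symmetric])
    show "response v (m + 1) + response w (m + 1) =
        B m (response v m + response w m) + (if m + 1 = 0 then v + w else 0)" for m
      unfolding response_recurrence by (simp add: blinfun.add_right)
    show "norm (response v m + response w m) \<le> 2 * C * K 0 * norm v + 2 * C * K 0 * norm w" for m
      by (intro order.trans[OF norm_triangle_ineq] add_mono norm_response_le_const)
  qed
  show "response (r *\<^sub>R v) m = r *\<^sub>R response v m"
  proof (rule response_unique[symmetric])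
    show "r *\<^sub>R response v (m + 1) = B m (r *\<^sub>R response v m) + (if m + 1 = 0 then r *\<^sub>R v else 0)" for m
      unfolding response_recurrence by (simp add: blinfun.scaleR_right scaleR_add_right)
    show "norm (r *\<^sub>R response v m) \<le> \<bar>r\<bar> * (2 * C * K 0 * norm v)" for m
      by (simp add: mult_left_mono norm_response_le_const)
  qed
  show "norm (response v m) \<le> norm v * (2 * C * K 0)"
    using norm_response_le_const[of v m] by (simp add: mult_ac)
qed

end

section \<open>Two-sided orbits and tempered functions\<close>

definition orbit :: "('w \<Rightarrow> 'w) \<Rightarrow> int \<Rightarrow> 'w \<Rightarrow> 'w" where
  "orbit \<sigma> m = (if 0 \<le> m then \<sigma> ^^ nat m else inv \<sigma> ^^ nat (- m))"

lemma orbit_0 [simp]: "orbit \<sigma> 0 \<omega> = \<omega>"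
  by (simp add: orbit_def)

lemma orbit_int [simp]: "orbit \<sigma> (int n) = \<sigma> ^^ n"
  by (simp add: orbit_def)

lemma orbit_minus_int [simp]: "orbit \<sigma> (- int n) = inv \<sigma> ^^ n"
  by (cases "n = 0") (simp_all add: orbit_def)

lemma orbit_Suc:
  assumes "bij \<sigma>"
  shows "orbit \<sigma> (m + 1) \<omega> = \<sigma> (orbit \<sigma> m \<omega>)"
proof (cases m rule: int_cases2)
  case (nonneg n)
  then have "m + 1 = int (Suc n)" by simp
  then show ?thesis unfolding nonneg by (simp only: orbit_int funpow.simps comp_apply)
next
  case (nonpos n)
  show ?thesis
  proof (cases n)
    case (Suc k)
    then have "m + 1 = - int k" using nonpos by simp
    then show ?thesis
      unfolding nonpos Suc orbit_minus_int using assms by (simp add: bij_is_surj surj_f_inv_f)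
  qed (use nonpos orbit_int[of \<sigma> 1] in simp)
qed

lemma orbit_add_int:
  fixes \<sigma> :: "'w \<Rightarrow> 'w"
  assumes "bij \<sigma>" shows "orbit \<sigma> (m + int n) \<omega> = (\<sigma> ^^ n) (orbit \<sigma> m \<omega>)"
proof (induction n)
  case (Suc n)
  have "m + int (Suc n) = m + int n + 1" by simp
  then show ?case
    by (simp only: orbit_Suc[OF assms] Suc funpow.simps comp_apply)
qed simp

lemma funpow_inv_cancel:
  fixes \<sigma> :: "'w \<Rightarrow> 'w"
  assumes "bij \<sigma>" shows "(inv \<sigma> ^^ n) ((\<sigma> ^^ n) \<omega>) = \<omega>"
proof (induction n)
  case (Suc n)
  have "(inv \<sigma> ^^ Suc n) ((\<sigma> ^^ Suc n) \<omega>) = (inv \<sigma> ^^ n) (inv \<sigma> (\<sigma> ((\<sigma> ^^ n) \<omega>)))"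
    by (simp only: funpow_Suc_right[of n "inv \<sigma>"] funpow.simps(2)[of n \<sigma>] comp_apply)
  then show ?case by (simp only: inv_f_f[OF bij_is_inj[OF assms]] Suc)
qed simp

lemma funpow_cancel_inv:
  fixes \<sigma> :: "'w \<Rightarrow> 'w"
  assumes "bij \<sigma>" shows "(\<sigma> ^^ n) ((inv \<sigma> ^^ n) \<omega>) = \<omega>"
  using funpow_inv_cancel[OF bij_imp_bij_inv[OF assms], of n \<omega>] assms by (simp add: inv_inv_eq)

lemma orbit_diff_int:
  fixes \<sigma> :: "'w \<Rightarrow> 'w"
  assumes "bij \<sigma>" shows "orbit \<sigma> (m - int n) \<omega> = (inv \<sigma> ^^ n) (orbit \<sigma> m \<omega>)"
proof -
  have "orbit \<sigma> m \<omega> = (\<sigma> ^^ n) (orbit \<sigma> (m - int n) \<omega>)"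
    using orbit_add_int[OF assms, of "m - int n" n \<omega>] by simp
  then show ?thesis by (simp only: funpow_inv_cancel[OF assms])
qed

lemma orbit_in_invariant:
  assumes "bij \<sigma>" "\<sigma> -` \<Omega> = \<Omega>" "\<omega> \<in> \<Omega>"
  shows "orbit \<sigma> m \<omega> \<in> \<Omega>"
proof -
  have f: "(\<sigma> ^^ n) \<omega> \<in> \<Omega>" for n
    by (induction n) (use assms in auto)
  have i: "(inv \<sigma> ^^ n) \<omega> \<in> \<Omega>" for n
  proof (induction n)
    case (Suc n)
    then have "inv \<sigma> ((inv \<sigma> ^^ n) \<omega>) \<in> \<sigma> -` \<Omega>"
      using assms(1) by (simp add: bij_is_surj surj_f_inv_f)
    then show ?case using assms(2) by simp
  qed (use assms in simp)
  show ?thesis using f i by (simp add: orbit_def)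
qed

section \<open>Null sets and invariant sets of the base\<close>

context aperiodic_ergodic_system
begin

lemma space_UNIV: "space M = UNIV"
  using sets_eq_imp_space_eq[OF sets_borel] by simp

lemma measurable_orbit: "orbit \<sigma> m \<in> measurable M M"
  unfolding orbit_def
  using measurable_base measurable_base_inv by (auto intro: measurable_compose_n)

lemma null_sets_vimage_base:
  assumes "N \<in> null_sets M" shows "\<sigma> -` N \<in> null_sets M"
proof -
  have "emeasure (distr M M \<sigma>) N = emeasure M (\<sigma> -` N)"
    using assms measurable_base by (subst emeasure_distr) (auto simp: space_UNIV)
  moreover have "\<sigma> -` N \<in> sets M"
    using measurable_sets[OF measurable_base, of N] assms by (auto simp: space_UNIV)
  moreover have "emeasure M N = 0" using assms by auto
  ultimately show ?thesis by (simp only: preserves null_sets_def) simp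
qed

lemma null_sets_vimage_inv:
  assumes "N \<in> null_sets M" shows "inv \<sigma> -` N \<in> null_sets M"
proof -
  have m: "inv \<sigma> -` N \<in> sets M"
    using measurable_sets[OF measurable_base_inv, of N] assms by (auto simp: space_UNIV)
  have "emeasure (distr M M \<sigma>) (inv \<sigma> -` N) = emeasure M (\<sigma> -` (inv \<sigma> -` N))"
    using m measurable_base by (subst emeasure_distr) (auto simp: space_UNIV)
  moreover have "\<sigma> -` (inv \<sigma> -` N) = N"
    using bij_base by (auto simp: bij_is_inj)
  ultimately have "emeasure M (inv \<sigma> -` N) = emeasure M N" by (simp only: preserves)
  then show ?thesis using assms m by (simp add: null_sets_def)
qed

lemma null_sets_vimage_orbit:
  assumes "N \<in> null_sets M" shows "orbit \<sigma> m -` N \<in> null_sets M"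
proof -
  have "(f ^^ n) -` N \<in> null_sets M"
    if step: "\<And>N. N \<in> null_sets M \<Longrightarrow> f -` N \<in> null_sets M" and "N \<in> null_sets M" for f n N
    using that(2)
  proof (induction n arbitrary: N)
    case (Suc n)
    have "(f ^^ Suc n) -` N = (f ^^ n) -` (f -` N)" by auto
    then show ?case using Suc.IH[OF step[OF Suc.prems]] by (simp only:)
  qed simp
  then show ?thesis
    using assms null_sets_vimage_base null_sets_vimage_inv by (simp add: orbit_def)
qed

text \<open>All preimages of an exceptional null set under integer powers of \<open>\<sigma>\<close>
  are removed; their union is countable, hence null, and invariant. Thus a property valid almost
  everywhere holds at every point of an orbit simultaneously.\<close>

lemma AE_invariant_set:
  assumes "AE \<omega> in M. Q \<omega>"
  obtains \<Omega> where "\<Omega> \<in> sets M" "prob \<Omega> = 1" "\<sigma> -` \<Omega> = \<Omega>" "\<And>\<omega>. \<omega> \<in> \<Omega> \<Longrightarrow> Q \<omega>"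
proof -
  obtain N where N: "N \<in> null_sets M" "{\<omega>. \<not> Q \<omega>} \<subseteq> N"
    using assms unfolding eventually_ae_filter space_UNIV by auto
  define Z where "Z = (\<Union>m. orbit \<sigma> m -` N)"
  have Z: "Z \<in> null_sets M"
    unfolding Z_def by (intro null_sets_UN null_sets_vimage_orbit N)
  have inv: "\<sigma> \<omega> \<in> Z \<longleftrightarrow> \<omega> \<in> Z" for \<omega>
  proof -
    have 1: "orbit \<sigma> 1 \<omega> = \<sigma> \<omega>" using orbit_int[of \<sigma> 1] by simp
    have "orbit \<sigma> m (\<sigma> \<omega>) = orbit \<sigma> (m + 1) \<omega>" for m
    proof (cases m rule: int_cases2)
      case (nonneg n)
      show ?thesis
        using orbit_add_int[OF bij_base, of 1 n \<omega>] by (simp only: nonneg orbit_int 1 add.commute)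
    next
      case (nonpos n)
      show ?thesis
        using orbit_diff_int[OF bij_base, of 1 n \<omega>] by (simp add: nonpos 1)
    qed
    then have "\<sigma> \<omega> \<in> Z \<longleftrightarrow> (\<exists>m. orbit \<sigma> (m + 1) \<omega> \<in> N)" by (simp add: Z_def)
    also have "\<dots> \<longleftrightarrow> (\<exists>m. orbit \<sigma> m \<omega> \<in> N)"
    proof
      assume "\<exists>m. orbit \<sigma> m \<omega> \<in> N"
      then obtain m where "orbit \<sigma> (m - 1 + 1) \<omega> \<in> N" by auto
      then show "\<exists>m. orbit \<sigma> (m + 1) \<omega> \<in> N" by blast
    qed blast
    finally show ?thesis by (simp add: Z_def)
  qed
  show thesis
  proof (rule that)
    show "\<sigma> -` (- Z) = - Z" using inv by auto
    have "space M - Z \<in> sets M" using Z by (intro sets.compl_sets) auto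
    then show "- Z \<in> sets M" by (simp add: space_UNIV Compl_eq_Diff_UNIV)
    have "prob (space M - Z) = 1 - prob Z" using Z by (intro prob_compl) auto
    then show "prob (- Z) = 1"
      using measure_eq_0_null_sets[OF Z] by (simp add: space_UNIV Compl_eq_Diff_UNIV)
    show "Q \<omega>" if "\<omega> \<in> - Z" for \<omega>
    proof -
      have "orbit \<sigma> 0 \<omega> \<notin> N" using that unfolding Z_def by blast
      then show ?thesis using N by auto
    qed
  qed
qed

end

section \<open>Pointwise temperedness and operations preserving it\<close>

definition tempered_at :: "('w \<Rightarrow> 'w) \<Rightarrow> ('w \<Rightarrow> real) \<Rightarrow> 'w \<Rightarrow> bool" where
  "tempered_at \<sigma> K \<omega> \<longleftrightarrow>
     (\<lambda>n. ln (K ((\<sigma> ^^ n) \<omega>)) / real n) \<longlonglongrightarrow> 0 \<and>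
     (\<lambda>n. ln (K ((inv \<sigma> ^^ n) \<omega>)) / real n) \<longlonglongrightarrow> 0"

lemma tempered_iff:
  "tempered M \<sigma> K \<longleftrightarrow> K \<in> borel_measurable M \<and> (\<forall>\<omega>. K \<omega> > 0) \<and> (AE \<omega> in M. tempered_at \<sigma> K \<omega>)"
proof -
  have "(\<lambda>n. - (ln (K ((inv \<sigma> ^^ n) \<omega>)) / real n)) \<longlonglongrightarrow> 0 \<longleftrightarrow> (\<lambda>n. ln (K ((inv \<sigma> ^^ n) \<omega>)) / real n) \<longlonglongrightarrow> 0" for \<omega>
    using tendsto_minus_cancel_left[of "\<lambda>n. ln (K ((inv \<sigma> ^^ n) \<omega>)) / real n" 0 sequentially] by simp
  then show ?thesis
    by (simp add: tempered_def tempered_at_def)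
qed

text \<open>Eventually \<open>k n\<close> is at most \<open>exp (\<beta> / 2 * n)\<close>, and half
  of the exponential rate remains.\<close>

lemma tempered_sequence_tendsto:
  assumes k: "\<And>n. k n > 0" and lim: "(\<lambda>n. ln (k n) / real n) \<longlonglongrightarrow> 0" and "\<beta> > 0"
  shows "(\<lambda>n. k n * exp (- \<beta> * real n)) \<longlonglongrightarrow> 0"
proof (rule tendsto_sandwich[where f = "\<lambda>_. 0"])
  have "eventually (\<lambda>n. ln (k n) / real n < \<beta> / 2) sequentially"
    using order_tendstoD(2)[OF lim, of "\<beta> / 2"] \<open>\<beta> > 0\<close> by simp
  then show "eventually (\<lambda>n. k n * exp (- \<beta> * real n) \<le> exp (- \<beta> / 2) ^ n) sequentially"
    using eventually_gt_at_top[of 0]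
  proof eventually_elim
    case (elim n)
    then have "ln (k n) \<le> \<beta> / 2 * real n" by (simp add: field_simps)
    then have "k n \<le> exp (\<beta> / 2 * real n)" using k[of n] by (simp add: ln_le_cancel_iff[symmetric] del: ln_le_cancel_iff)
    then have "k n * exp (- \<beta> * real n) \<le> exp (\<beta> / 2 * real n) * exp (- \<beta> * real n)"
      by (intro mult_right_mono) auto
    also have "\<dots> = exp (- \<beta> / 2) ^ n"
      by (simp add: exp_add[symmetric] exp_of_nat_mult[symmetric] field_simps)
    finally show ?case .
  qed
  show "(\<lambda>n. exp (- \<beta> / 2) ^ n) \<longlonglongrightarrow> 0"
    using \<open>\<beta> > 0\<close> by (intro LIMSEQ_power_zero) auto
qed (use k in \<open>auto simp: less_imp_le\<close>)

text \<open>Since 1 + a k \<le> (1 + a) max 1 k, the logarithm lies between 0 and ln (1 + a) + |ln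
  k|. This makes the new bound \<open>K'\<close> tempered; the summand 1 keeps the logarithm
  nonnegative.\<close>

lemma tempered_affine:
  assumes "tempered M \<sigma> K" "a > 0"
  shows "tempered M \<sigma> (\<lambda>\<omega>. 1 + a * K \<omega>)"
proof -
  have K: "K \<in> borel_measurable M" "\<And>\<omega>. K \<omega> > 0" "AE \<omega> in M. tempered_at \<sigma> K \<omega>"
    using assms(1) by (auto simp: tempered_iff)
  have lim: "(\<lambda>n. ln (1 + a * k n) / real n) \<longlonglongrightarrow> 0"
    if k: "\<And>n. k n > 0" and lim: "(\<lambda>n. ln (k n) / real n) \<longlonglongrightarrow> 0" for k :: "nat \<Rightarrow> real"
  proof (rule Lim_null_comparison)
    show "(\<lambda>n. ln (1 + a) / real n + \<bar>ln (k n) / real n\<bar>) \<longlonglongrightarrow> 0"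
      using tendsto_add[OF lim_const_over_n tendsto_rabs_zero[OF lim]] by simp
    have "ln (1 + a * k n) \<le> ln (1 + a) + \<bar>ln (k n)\<bar>" for n
    proof -
      have "1 + a * k n \<le> (1 + a) * max 1 (k n)"
        using assms(2) k[of n] by (auto simp: max_def algebra_simps not_le intro: mult_left_mono)
      then have "ln (1 + a * k n) \<le> ln ((1 + a) * max 1 (k n))"
        using assms(2) k[of n] by (intro ln_mono) (auto intro: add_pos_pos)
      also have "\<dots> = ln (1 + a) + ln (max 1 (k n))"
        using assms(2) by (intro ln_mult_pos) auto
      also have "ln (max 1 (k n)) \<le> \<bar>ln (k n)\<bar>" by (auto simp: max_def)
      finally show ?thesis by simp
    qed
    moreover have "0 \<le> ln (1 + a * k n)" for n using assms(2) k[of n] by simp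
    ultimately have "norm (ln (1 + a * k n) / real n) \<le> ln (1 + a) / real n + \<bar>ln (k n) / real n\<bar>" for n
      by (auto simp: abs_of_nonneg add_divide_distrib[symmetric] abs_divide intro!: divide_right_mono)
    then show "\<forall>\<^sub>F n in sequentially. norm (ln (1 + a * k n) / real n) \<le> ln (1 + a) / real n + \<bar>ln (k n) / real n\<bar>"
      by simp
  qed
  have "AE \<omega> in M. tempered_at \<sigma> (\<lambda>\<omega>. 1 + a * K \<omega>) \<omega>"
    using K(3) by eventually_elim (auto simp: tempered_at_def intro!: lim K(2))
  then show ?thesis
    using K(1,2) assms(2) by (auto simp: tempered_iff intro!: add_pos_pos mult_pos_pos)
qed

text \<open>This is the shape of \<open>c\<close>. Inversion only changes the sign of the logarithm,
  the constant disappears after division by \<open>n\<close>, and the shift by one step replaces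
  \<open>n\<close> by a neighbouring divisor with quotient tending to 1.\<close>

lemma (in aperiodic_ergodic_system) tempered_inverse_shift:
  assumes "tempered M \<sigma> K" "a > 0"
  shows "tempered M \<sigma> (\<lambda>\<omega>. a / K (\<sigma> \<omega>))"
proof -
  have K: "K \<in> borel_measurable M" "\<And>\<omega>. K \<omega> > 0" "AE \<omega> in M. tempered_at \<sigma> K \<omega>"
    using assms(1) by (auto simp: tempered_iff)
  have const: "(\<lambda>n. ln (a / k n) / real n) \<longlonglongrightarrow> 0"
    if k: "\<And>n. k n > 0" and lim: "(\<lambda>n. ln (k n) / real n) \<longlonglongrightarrow> 0" for k :: "nat \<Rightarrow> real"
    using tendsto_diff[OF lim_const_over_n[of "ln a"] lim] k assms(2)
    by (simp add: ln_div diff_divide_distrib less_imp_neq[OF k, symmetric])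
  have up: "(\<lambda>n. ln (k (Suc n)) / real n) \<longlonglongrightarrow> 0"
    if lim: "(\<lambda>n. ln (k n) / real n) \<longlonglongrightarrow> 0" for k :: "nat \<Rightarrow> real"
  proof (rule Lim_transform_eventually)
    have "(\<lambda>n. real (Suc n) / real n) \<longlonglongrightarrow> 1" by (rule LIMSEQ_Suc_n_over_n)
    from tendsto_mult[OF LIMSEQ_Suc[OF lim] this]
    show "(\<lambda>n. ln (k (Suc n)) / real (Suc n) * (real (Suc n) / real n)) \<longlonglongrightarrow> 0" by simp
  qed (simp del: of_nat_Suc)
  have down: "(\<lambda>n. ln (k (Suc n)) / real (Suc (Suc n))) \<longlonglongrightarrow> 0"
    if lim: "(\<lambda>n. ln (k n) / real n) \<longlonglongrightarrow> 0" for k :: "nat \<Rightarrow> real"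
  proof (rule Lim_transform_eventually)
    have "(\<lambda>n. real (Suc n) / real (Suc (Suc n))) \<longlonglongrightarrow> 1"
      using LIMSEQ_Suc[OF LIMSEQ_n_over_Suc_n] by simp
    from tendsto_mult[OF LIMSEQ_Suc[OF lim] this]
    show "(\<lambda>n. ln (k (Suc n)) / real (Suc n) * (real (Suc n) / real (Suc (Suc n)))) \<longlonglongrightarrow> 0" by simp
  qed (simp del: of_nat_Suc)
  have "tempered_at \<sigma> (\<lambda>\<omega>. a / K (\<sigma> \<omega>)) \<omega>" if t: "tempered_at \<sigma> K \<omega>" for \<omega>
  proof -
    have "(\<lambda>n. ln (a / K ((\<sigma> ^^ Suc n) \<omega>)) / real n) \<longlonglongrightarrow> 0"
      by (rule const[OF _ up]) (use t K(2) in \<open>auto simp: tempered_at_def\<close>)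
    moreover have "(\<lambda>n. ln (a / K (\<sigma> ((inv \<sigma> ^^ n) \<omega>))) / real n) \<longlonglongrightarrow> 0"
    proof (rule const)
      \<comment> \<open>Two initial terms are dropped: one so that \<open>\<sigma>\<close> cancels
        an inverse, another so that the divisor after cancellation is still positive.\<close>
      have eq: "\<sigma> ((inv \<sigma> ^^ Suc (Suc n)) \<omega>) = (inv \<sigma> ^^ Suc n) \<omega>" for n
        using bij_base by (simp add: bij_is_surj surj_f_inv_f)
      have "(\<lambda>n. ln (K (\<sigma> ((inv \<sigma> ^^ Suc (Suc n)) \<omega>))) / real (Suc (Suc n))) \<longlonglongrightarrow> 0"
        unfolding eq using down[of "\<lambda>n. K ((inv \<sigma> ^^ n) \<omega>)"] t by (simp add: tempered_at_def)
      then show "(\<lambda>n. ln (K (\<sigma> ((inv \<sigma> ^^ n) \<omega>))) / real n) \<longlonglongrightarrow> 0"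
        by (rule LIMSEQ_imp_Suc[OF LIMSEQ_imp_Suc])
    qed (use K(2) in auto)
    ultimately show ?thesis by (simp add: tempered_at_def)
  qed
  then have "AE \<omega> in M. tempered_at \<sigma> (\<lambda>\<omega>. a / K (\<sigma> \<omega>)) \<omega>"
    by (rule eventually_mono[OF K(3)])
  moreover have "(\<lambda>\<omega>. a / K (\<sigma> \<omega>)) \<in> borel_measurable M"
    using measurable_compose[OF measurable_base K(1)] by simp
  ultimately show ?thesis
    using K(2) assms(2) by (auto simp: tempered_iff)
qed

text \<open>Strong measurability speaks only of fixed arguments. A simple function takes finitely
  many values and reduces to that case; continuity of each operator carries the result to the
  limit.\<close>

lemma measurable_blinfun_compose:
  fixes T :: "'w \<Rightarrow> 'a::{real_normed_vector, second_countable_topology} \<Rightarrow>\<^sub>L 'b::real_normed_vector"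
  assumes T: "\<And>x. (\<lambda>\<omega>. T \<omega> x) \<in> borel_measurable N" and h: "h \<in> borel_measurable N"
  shows "(\<lambda>\<omega>. T \<omega> (h \<omega>)) \<in> borel_measurable N"
proof -
  obtain F where F: "\<And>i. simple_function N (F i)"
      "\<And>\<omega>. \<omega> \<in> space N \<Longrightarrow> (\<lambda>i. F i \<omega>) \<longlonglongrightarrow> h \<omega>"
    using borel_measurable_implies_sequence_metric[OF h, of 0] by metis
  show ?thesis
  proof (rule borel_measurable_LIMSEQ_metric)
    fix i
    have fin: "finite (F i ` space N)" using F(1)[of i] by (rule simple_functionD)
    have "F i \<in> measurable N (count_space (F i ` space N))"
      using fin simple_functionD(2)[OF F(1)[of i]] by (subst measurable_count_space_eq2) auto
    then show "(\<lambda>\<omega>. T \<omega> (F i \<omega>)) \<in> borel_measurable N"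
      by (rule measurable_compose_countable'[rotated]) (use fin T countable_finite in auto)
  next
    fix \<omega> assume "\<omega> \<in> space N"
    then show "(\<lambda>i. T \<omega> (F i \<omega>)) \<longlonglongrightarrow> T \<omega> (h \<omega>)"
      by (intro tendsto_intros F(2))
  qed
qed

lemma exists_dense_sequence:
  obtains d :: "nat \<Rightarrow> 'a::{metric_space, second_countable_topology}"
    where "\<And>x e. e > 0 \<Longrightarrow> \<exists>i. dist (d i) x < e"
proof -
  obtain D :: "'a set" where D: "countable D" "\<And>X. open X \<Longrightarrow> X \<noteq> {} \<Longrightarrow> \<exists>d\<in>D. d \<in> X"
    by (rule countable_dense_setE) blast
  have "D \<noteq> {}" using D(2)[of UNIV] by auto
  have "\<exists>i. dist (from_nat_into D i) x < e" if "e > 0" for x e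
  proof -
    obtain y where "y \<in> D" "y \<in> ball x e" using D(2)[of "ball x e"] \<open>e > 0\<close> by fastforce
    then show ?thesis by (metis D(1) dist_commute from_nat_into_surj mem_ball)
  qed
  then show thesis by (rule that)
qed

section \<open>The perturbed cocycle\<close>

lemma bij_betw_cocycle:
  assumes cocycle: "linear_cocycle M \<sigma> \<A>" and inv: "\<sigma> -` \<Omega> = \<Omega>"
    and step: "\<And>\<omega>. \<omega> \<in> \<Omega> \<Longrightarrow> bij_betw (blinfun_apply (\<A> \<omega> 1)) (Ker (P \<omega>)) (Ker (P (\<sigma> \<omega>)))"
    and "\<omega> \<in> \<Omega>"
  shows "bij_betw (blinfun_apply (\<A> \<omega> n)) (Ker (P \<omega>)) (Ker (P ((\<sigma> ^^ n) \<omega>)))"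
proof (induction n)
  case 0
  have "blinfun_apply (\<A> \<omega> 0) = id" using cocycle by (auto simp: linear_cocycle_def)
  then show ?case by (simp only: funpow_0 bij_betw_id)
next
  case (Suc n)
  have "(\<sigma> ^^ n) \<omega> \<in> \<Omega>"
    by (induction n) (use \<open>\<omega> \<in> \<Omega>\<close> inv in auto)
  from bij_betw_trans[OF Suc step[OF this]]
  have "bij_betw (blinfun_apply (\<A> ((\<sigma> ^^ n) \<omega>) 1) \<circ> blinfun_apply (\<A> \<omega> n)) (Ker (P \<omega>)) (Ker (P ((\<sigma> ^^ Suc n) \<omega>)))"
    by simp
  moreover have "\<A> \<omega> (1 + n) = \<A> ((\<sigma> ^^ n) \<omega>) 1 o\<^sub>L \<A> \<omega> n"
    using cocycle unfolding linear_cocycle_def by blast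
  then have "blinfun_apply (\<A> \<omega> (Suc n)) = blinfun_apply (\<A> ((\<sigma> ^^ n) \<omega>) 1) \<circ> blinfun_apply (\<A> \<omega> n)"
    by auto
  ultimately show ?case by (simp only:)
qed

text \<open>All almost sure conditions are already collected in one invariant set
  \<open>\<Omega>\<close>, so they hold along the whole orbit of each of its points. The condition
  \<open>close\<close> uses \<open>K (\<sigma> \<omega>)\<close> because the error of the generator
  at \<omega> becomes a source at the next orbit point.\<close>

locale perturbed_cocycle = aperiodic_ergodic_system M \<sigma>
  for M :: "'w::polish_space measure" and \<sigma> +
  fixes \<A> \<B> :: "'w \<Rightarrow> nat \<Rightarrow> ('a::{banach, second_countable_topology} \<Rightarrow>\<^sub>L 'a)"
    and \<Omega> :: "'w set" and K :: "'w \<Rightarrow> real" and \<beta> :: real and P :: "'w \<Rightarrow> 'a \<Rightarrow>\<^sub>L 'a"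
  assumes cocycle: "linear_cocycle M \<sigma> \<A>" and cocycle': "linear_cocycle M \<sigma> \<B>"
    and \<Omega>_sets: "\<Omega> \<in> sets M" and \<Omega>_prob: "prob \<Omega> = 1" and \<Omega>_inv: "\<sigma> -` \<Omega> = \<Omega>"
    and K_tempered: "tempered M \<sigma> K"
    and K_at: "\<And>\<omega>. \<omega> \<in> \<Omega> \<Longrightarrow> tempered_at \<sigma> K \<omega>"
    and beta_pos: "\<beta> > 0"
    and P_idem: "\<And>\<omega>. P \<omega> o\<^sub>L P \<omega> = P \<omega>"
    and P_meas: "\<And>v. (\<lambda>\<omega>. P \<omega> v) \<in> borel_measurable M"
    and P_comm: "\<And>\<omega>. \<omega> \<in> \<Omega> \<Longrightarrow> P (\<sigma> \<omega>) o\<^sub>L \<A> \<omega> 1 = \<A> \<omega> 1 o\<^sub>L P \<omega>"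
    and A_bij: "\<And>\<omega>. \<omega> \<in> \<Omega> \<Longrightarrow> bij_betw (blinfun_apply (\<A> \<omega> 1)) (Ker (P \<omega>)) (Ker (P (\<sigma> \<omega>)))"
    and A_stable: "\<And>\<omega> n. \<omega> \<in> \<Omega> \<Longrightarrow> norm (\<A> \<omega> n o\<^sub>L P \<omega>) \<le> K \<omega> * exp (- \<beta> * real n)"
    and A_unstable_linear: "\<And>\<omega> n. \<omega> \<in> \<Omega> \<Longrightarrow>
      bounded_linear (\<lambda>x. backward_cocycle \<sigma> \<A> P \<omega> n (x - blinfun_apply (P \<omega>) x))"
    and A_unstable: "\<And>\<omega> n. \<omega> \<in> \<Omega> \<Longrightarrow>
      onorm (\<lambda>x. backward_cocycle \<sigma> \<A> P \<omega> n (x - blinfun_apply (P \<omega>) x)) \<le> K \<omega> * exp (- \<beta> * real n)"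
    and close: "\<And>\<omega>. \<omega> \<in> \<Omega> \<Longrightarrow>
      K (\<sigma> \<omega>) * norm (\<A> \<omega> 1 - \<B> \<omega> 1) \<le> exp (- \<beta> / 2) / (2 * green_const \<beta>)"
begin

section \<open>Backward evolution along the unperturbed kernels\<close>

definition V :: "'w \<Rightarrow> nat \<Rightarrow> 'a \<Rightarrow> 'a" where
  "V \<omega> n x = backward_cocycle \<sigma> \<A> P \<omega> n (x - P \<omega> x)"

lemma K_pos: "K \<omega> > 0"
  using K_tempered by (simp add: tempered_iff)

lemma orbit_\<Omega>: "\<omega> \<in> \<Omega> \<Longrightarrow> orbit \<sigma> m \<omega> \<in> \<Omega>"
  by (rule orbit_in_invariant[OF bij_base \<Omega>_inv])

lemma funpow_\<Omega>: "\<omega> \<in> \<Omega> \<Longrightarrow> (\<sigma> ^^ n) \<omega> \<in> \<Omega>"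
  using orbit_\<Omega>[of \<omega> "int n"] by simp

lemma funpow_inv_\<Omega>: "\<omega> \<in> \<Omega> \<Longrightarrow> (inv \<sigma> ^^ n) \<omega> \<in> \<Omega>"
  using orbit_\<Omega>[of \<omega> "- int n"] by simp

lemma step_\<Omega>: "\<omega> \<in> \<Omega> \<Longrightarrow> \<sigma> \<omega> \<in> \<Omega>"
  using \<Omega>_inv by auto

lemma step_inv_Suc: "\<sigma> ((inv \<sigma> ^^ Suc n) \<omega>) = (inv \<sigma> ^^ n) \<omega>"
  by (simp only: funpow.simps comp_apply surj_f_inv_f[OF bij_is_surj[OF bij_base]])

lemma inv_step: "(inv \<sigma> ^^ Suc n) (\<sigma> \<omega>) = (inv \<sigma> ^^ n) \<omega>"
  by (simp only: funpow_Suc_right comp_apply inv_f_f[OF bij_is_inj[OF bij_base]])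

lemma A_Suc: "\<A> \<omega> (Suc n) = \<A> ((\<sigma> ^^ n) \<omega>) 1 o\<^sub>L \<A> \<omega> n"
proof -
  have "\<A> \<omega> (1 + n) = \<A> ((\<sigma> ^^ n) \<omega>) 1 o\<^sub>L \<A> \<omega> n"
    using cocycle unfolding linear_cocycle_def by blast
  then show ?thesis by simp
qed

lemma A_0: "\<A> \<omega> 0 = id_blinfun"
  using cocycle by (simp add: linear_cocycle_def)

lemma P_P: "P \<omega> (P \<omega> x) = P \<omega> x"
  unfolding blinfun_apply_blinfun_compose[symmetric] P_idem ..

lemma P_comm_apply: "\<omega> \<in> \<Omega> \<Longrightarrow> P (\<sigma> \<omega>) (\<A> \<omega> 1 x) = \<A> \<omega> 1 (P \<omega> x)"
  unfolding blinfun_apply_blinfun_compose[symmetric] P_comm ..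

lemma P_comm_n: "\<omega> \<in> \<Omega> \<Longrightarrow> P ((\<sigma> ^^ n) \<omega>) (\<A> \<omega> n x) = \<A> \<omega> n (P \<omega> x)"
proof (induction n)
  case (Suc n)
  then show ?case using P_comm_apply[OF funpow_\<Omega>, of \<omega> n "\<A> \<omega> n x"] by (simp add: A_Suc[of \<omega> n])
qed (simp add: A_0)

lemma diff_P_Ker: "x - P \<omega> x \<in> Ker (P \<omega>)"
  by (simp add: Ker_def blinfun.diff_right P_P)

lemma A_bij_back:
  assumes "\<omega> \<in> \<Omega>"
  shows "bij_betw (blinfun_apply (\<A> ((inv \<sigma> ^^ n) \<omega>) n)) (Ker (P ((inv \<sigma> ^^ n) \<omega>))) (Ker (P \<omega>))"
proof -
  have "bij_betw (blinfun_apply (\<A> ((inv \<sigma> ^^ n) \<omega>) n)) (Ker (P ((inv \<sigma> ^^ n) \<omega>)))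
      (Ker (P ((\<sigma> ^^ n) ((inv \<sigma> ^^ n) \<omega>))))"
    by (rule bij_betw_cocycle[OF cocycle \<Omega>_inv _ funpow_inv_\<Omega>[OF assms], where P = P]) (rule A_bij)
  then show ?thesis by (simp only: funpow_cancel_inv[OF bij_base])
qed

lemma V_Ker: "\<omega> \<in> \<Omega> \<Longrightarrow> V \<omega> n x \<in> Ker (P ((inv \<sigma> ^^ n) \<omega>))"
  unfolding V_def backward_cocycle_def
  using A_bij_back[of \<omega> n] diff_P_Ker[of x \<omega>]
  by (auto simp: bij_betw_def intro!: the_inv_into_into)

lemma A_V: "\<omega> \<in> \<Omega> \<Longrightarrow> \<A> ((inv \<sigma> ^^ n) \<omega>) n (V \<omega> n x) = x - P \<omega> x"
  unfolding V_def backward_cocycle_def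
  using A_bij_back[of \<omega> n] diff_P_Ker[of x \<omega>]
  by (auto simp: bij_betw_def intro!: f_the_inv_into_f)

text \<open>Injectivity on the kernel: the identities for \<open>V\<close> are verified by applying
  the forward cocycle instead of manipulating inverses.\<close>

lemma V_unique:
  assumes "\<omega> \<in> \<Omega>" "y \<in> Ker (P ((inv \<sigma> ^^ n) \<omega>))" "\<A> ((inv \<sigma> ^^ n) \<omega>) n y = x - P \<omega> x"
  shows "V \<omega> n x = y"
  using A_bij_back[OF assms(1), of n] V_Ker[OF assms(1), of n x] A_V[OF assms(1), of n x] assms(2,3)
  unfolding bij_betw_def inj_on_def by metis

lemma V_0: "\<omega> \<in> \<Omega> \<Longrightarrow> V \<omega> 0 x = x - P \<omega> x"
  by (rule V_unique) (simp_all add: A_0 diff_P_Ker)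

lemma A_V_Suc:
  assumes "\<omega> \<in> \<Omega>"
  shows "\<A> ((inv \<sigma> ^^ Suc n) \<omega>) 1 (V \<omega> (Suc n) x) = V \<omega> n x"
proof (rule V_unique[OF assms, symmetric])
  let ?\<theta> = "(inv \<sigma> ^^ Suc n) \<omega>"
  have \<theta>: "?\<theta> \<in> \<Omega>" by (rule funpow_inv_\<Omega>[OF assms])
  show "\<A> ?\<theta> 1 (V \<omega> (Suc n) x) \<in> Ker (P ((inv \<sigma> ^^ n) \<omega>))"
    using A_bij[OF \<theta>] V_Ker[OF assms, of "Suc n" x] unfolding step_inv_Suc bij_betw_def by blast
  have "\<A> ?\<theta> (n + 1) = \<A> ((\<sigma> ^^ 1) ?\<theta>) n o\<^sub>L \<A> ?\<theta> 1"
    using cocycle unfolding linear_cocycle_def by blast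
  moreover have "(\<sigma> ^^ 1) ?\<theta> = (inv \<sigma> ^^ n) \<omega>" using step_inv_Suc[of n \<omega>] by simp
  ultimately have "\<A> ((inv \<sigma> ^^ n) \<omega>) n (\<A> ?\<theta> 1 (V \<omega> (Suc n) x)) = \<A> ?\<theta> (Suc n) (V \<omega> (Suc n) x)"
    by (metis Suc_eq_plus1 blinfun_apply_blinfun_compose)
  then show "\<A> ((inv \<sigma> ^^ n) \<omega>) n (\<A> ?\<theta> 1 (V \<omega> (Suc n) x)) = x - P \<omega> x"
    by (simp only: A_V[OF assms])
qed

lemma V_A:
  assumes "\<omega> \<in> \<Omega>"
  shows "V ((\<sigma> ^^ n) \<omega>) n (\<A> \<omega> n x) = x - P \<omega> x"
  by (rule V_unique[OF funpow_\<Omega>[OF assms]])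
    (simp_all add: funpow_inv_cancel[OF bij_base] diff_P_Ker P_comm_n[OF assms] blinfun.diff_right)

lemma norm_V_le:
  assumes "\<omega> \<in> \<Omega>"
  shows "norm (V \<omega> n x) \<le> K \<omega> * exp (- \<beta> * real n) * norm x"
proof -
  have "norm (V \<omega> n x) \<le> onorm (\<lambda>x. backward_cocycle \<sigma> \<A> P \<omega> n (x - P \<omega> x)) * norm x"
    unfolding V_def by (rule onorm[OF A_unstable_linear[OF assms]])
  also have "\<dots> \<le> K \<omega> * exp (- \<beta> * real n) * norm x"
    by (intro mult_right_mono A_unstable[OF assms]) auto
  finally show ?thesis .
qed

section \<open>Passage to the sequence over a single orbit\<close>

lemma perturbed_dichotomy_sequence_orbit:
  assumes "\<omega> \<in> \<Omega>"
  shows "perturbed_dichotomy_sequence (\<lambda>m. \<A> (orbit \<sigma> m \<omega>) 1) (\<lambda>m. P (orbit \<sigma> m \<omega>))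
     (\<lambda>m. \<A> (orbit \<sigma> m \<omega>)) (\<lambda>m. V (orbit \<sigma> m \<omega>)) (\<lambda>m. K (orbit \<sigma> m \<omega>)) \<beta>
     (\<lambda>m. \<B> (orbit \<sigma> m \<omega>) 1)"
proof
  have o: "orbit \<sigma> m \<omega> \<in> \<Omega>" for m by (rule orbit_\<Omega>[OF assms])
  note op = orbit_add_int[OF bij_base] orbit_diff_int[OF bij_base] orbit_Suc[OF bij_base]
  fix m :: int and n :: nat and x :: 'a
  show "\<beta> > 0" by (rule beta_pos)
  show "K (orbit \<sigma> m \<omega>) > 0" by (rule K_pos)
  show "\<A> (orbit \<sigma> m \<omega>) 0 = id_blinfun" by (rule A_0)
  show "\<A> (orbit \<sigma> m \<omega>) (Suc n) = \<A> (orbit \<sigma> (m + int n) \<omega>) 1 o\<^sub>L \<A> (orbit \<sigma> m \<omega>) n"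
    unfolding op by (rule A_Suc)
  show "P (orbit \<sigma> (m + 1) \<omega>) (\<A> (orbit \<sigma> m \<omega>) 1 x) = \<A> (orbit \<sigma> m \<omega>) 1 (P (orbit \<sigma> m \<omega>) x)"
    unfolding op by (rule P_comm_apply[OF o])
  have "norm (\<A> (orbit \<sigma> m \<omega>) n (P (orbit \<sigma> m \<omega>) x)) \<le> norm (\<A> (orbit \<sigma> m \<omega>) n o\<^sub>L P (orbit \<sigma> m \<omega>)) * norm x"
    by (metis blinfun_apply_blinfun_compose norm_blinfun)
  also have "\<dots> \<le> K (orbit \<sigma> m \<omega>) * exp (- \<beta> * real n) * norm x"
    by (intro mult_right_mono A_stable[OF o]) auto
  finally show "norm (\<A> (orbit \<sigma> m \<omega>) n (P (orbit \<sigma> m \<omega>) x)) \<le> K (orbit \<sigma> m \<omega>) * exp (- \<beta> * real n) * norm x" .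
  show "V (orbit \<sigma> m \<omega>) 0 x = x - P (orbit \<sigma> m \<omega>) x" by (rule V_0[OF o])
  have "m - 1 - int n = m - int (Suc n)" by simp
  then show "\<A> (orbit \<sigma> (m - 1 - int n) \<omega>) 1 (V (orbit \<sigma> m \<omega>) (Suc n) x) = V (orbit \<sigma> m \<omega>) n x"
    by (simp only: op A_V_Suc[OF o])
  show "V (orbit \<sigma> (m + int n) \<omega>) n (\<A> (orbit \<sigma> m \<omega>) n x) = x - P (orbit \<sigma> m \<omega>) x"
    unfolding op by (rule V_A[OF o])
  show "norm (V (orbit \<sigma> m \<omega>) n x) \<le> K (orbit \<sigma> m \<omega>) * exp (- \<beta> * real n) * norm x"
    by (rule norm_V_le[OF o])
  show "(\<lambda>n. K (orbit \<sigma> (m - int n) \<omega>) * exp (- \<beta> * real n)) \<longlonglongrightarrow> 0"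
    unfolding op
    by (rule tempered_sequence_tendsto[OF K_pos _ beta_pos]) (use K_at[OF o] in \<open>simp add: tempered_at_def\<close>)
  show "(\<lambda>n. K (orbit \<sigma> (m + int n) \<omega>) * exp (- \<beta> * real n)) \<longlonglongrightarrow> 0"
    unfolding op
    by (rule tempered_sequence_tendsto[OF K_pos _ beta_pos]) (use K_at[OF o] in \<open>simp add: tempered_at_def\<close>)
  have "K (orbit \<sigma> (m + 1) \<omega>) * norm (\<A> (orbit \<sigma> m \<omega>) 1 - \<B> (orbit \<sigma> m \<omega>) 1)
      \<le> exp (- \<beta> / 2) / (2 * green_const \<beta>)"
    unfolding op by (rule close[OF o])
  then show "K (orbit \<sigma> (m + 1) \<omega>) * norm (\<A> (orbit \<sigma> m \<omega>) 1 - \<B> (orbit \<sigma> m \<omega>) 1)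
      \<le> exp (- \<beta> / 2) / (2 * green_const \<beta>)" .
qed

text \<open>Exposes the iteration as a function of the base point, as needed to speak of its
  measurability. Its equations are available only on \<open>\<Omega>\<close>, where the sequence
  locale can be interpreted.\<close>

definition iterates :: "'w \<Rightarrow> 'a \<Rightarrow> nat \<Rightarrow> int \<Rightarrow> 'a" where
  "iterates \<omega> = perturbed_dichotomy_sequence.iter (\<lambda>m. \<A> (orbit \<sigma> m \<omega>) 1) (\<lambda>m. P (orbit \<sigma> m \<omega>))
     (\<lambda>m. \<A> (orbit \<sigma> m \<omega>)) (\<lambda>m. V (orbit \<sigma> m \<omega>)) (\<lambda>m. \<B> (orbit \<sigma> m \<omega>) 1)"

definition resp :: "'w \<Rightarrow> 'a \<Rightarrow> int \<Rightarrow> 'a" where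
  "resp \<omega> = perturbed_dichotomy_sequence.response (\<lambda>m. \<A> (orbit \<sigma> m \<omega>) 1) (\<lambda>m. P (orbit \<sigma> m \<omega>))
     (\<lambda>m. \<A> (orbit \<sigma> m \<omega>)) (\<lambda>m. V (orbit \<sigma> m \<omega>)) (\<lambda>m. \<B> (orbit \<sigma> m \<omega>) 1)"

definition \<beta>' :: real where "\<beta>' = \<beta> / 2"

text \<open>The factor \<open>2 * green_const \<beta> * K \<omega>\<close> bounds the response; the
  summand 1 is needed at time 0 on the unstable side, where \<open>v - PB \<omega> v\<close>
  contains \<open>v\<close> itself.\<close>

definition K' :: "'w \<Rightarrow> real" where "K' \<omega> = 1 + 2 * green_const \<beta> * K \<omega>"

lemma green_pos: "green_const \<beta> > 0"
  by (rule green_const_pos[OF beta_pos])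

lemma K'_pos: "K' \<omega> > 0"
  using green_pos K_pos[of \<omega>] by (simp add: K'_def add_pos_pos)

context
  fixes \<omega> assumes \<omega>: "\<omega> \<in> \<Omega>"
begin

interpretation seq: perturbed_dichotomy_sequence "\<lambda>m. \<A> (orbit \<sigma> m \<omega>) 1" "\<lambda>m. P (orbit \<sigma> m \<omega>)"
  "\<lambda>m. \<A> (orbit \<sigma> m \<omega>)" "\<lambda>m. V (orbit \<sigma> m \<omega>)" "\<lambda>m. K (orbit \<sigma> m \<omega>)" \<beta> "\<lambda>m. \<B> (orbit \<sigma> m \<omega>) 1"
  by (rule perturbed_dichotomy_sequence_orbit[OF \<omega>])

lemma resp_eq_lim: "resp \<omega> v m = lim (\<lambda>j. iterates \<omega> v j m)"
  unfolding resp_def iterates_def by (rule seq.response_def)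

lemma iterates_0: "iterates \<omega> v 0 m = 0"
  unfolding iterates_def seq.iter.simps ..

lemma iterates_Suc:
  "iterates \<omega> v (Suc j) m =
    (let g = \<lambda>n. (\<B> (orbit \<sigma> (n - 1) \<omega>) 1 - \<A> (orbit \<sigma> (n - 1) \<omega>) 1) (iterates \<omega> v j (n - 1)) + (if n = 0 then v else 0)
     in (\<Sum>j. \<A> (orbit \<sigma> (m - int j) \<omega>) j (P (orbit \<sigma> (m - int j) \<omega>) (g (m - int j))))
       - (\<Sum>j. V (orbit \<sigma> (m + int j + 1) \<omega>) (Suc j) (g (m + int j + 1))))"
  unfolding iterates_def Let_def seq.iter.simps seq.sol_def ..

lemma norm_resp_le: "norm (resp \<omega> v m) \<le> 2 * green_const \<beta> * K \<omega> * norm v * exp (- \<beta>' * \<bar>real_of_int m\<bar>)"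
  using seq.norm_response_le[of v m] by (simp add: resp_def \<beta>'_def)

lemma resp_recurrence:
  "resp \<omega> v (m + 1) = \<B> (orbit \<sigma> m \<omega>) 1 (resp \<omega> v m) + (if m + 1 = 0 then v else 0)"
  unfolding resp_def by (rule seq.response_recurrence)

lemma resp_unique:
  assumes "\<And>m. x (m + 1) = \<B> (orbit \<sigma> m \<omega>) 1 (x m) + (if m + 1 = 0 then v else 0)"
    and "\<And>m. norm (x m) \<le> b"
  shows "resp \<omega> v m = x m"
  unfolding resp_def using assms by (rule seq.response_unique[symmetric])

lemma bounded_linear_resp: "bounded_linear (\<lambda>v. resp \<omega> v m)"
  unfolding resp_def by (rule seq.bounded_linear_response)

end

text \<open>The value 0 off \<open>\<Omega>\<close> keeps \<open>PB\<close> a projection at every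
  point and preserves measurability on the whole space.\<close>

definition PB :: "'w \<Rightarrow> 'a \<Rightarrow>\<^sub>L 'a" where
  "PB \<omega> = (if \<omega> \<in> \<Omega> then Blinfun (\<lambda>v. resp \<omega> v 0) else 0)"

lemma PB_apply: "\<omega> \<in> \<Omega> \<Longrightarrow> PB \<omega> v = resp \<omega> v 0"
  by (simp add: PB_def bounded_linear_Blinfun_apply[OF bounded_linear_resp])

section \<open>The new projection in terms of bounded orbits\<close>

lemma B_Suc: "\<B> \<omega> (Suc n) = \<B> ((\<sigma> ^^ n) \<omega>) 1 o\<^sub>L \<B> \<omega> n"
proof -
  have "\<B> \<omega> (1 + n) = \<B> ((\<sigma> ^^ n) \<omega>) 1 o\<^sub>L \<B> \<omega> n"
    using cocycle' unfolding linear_cocycle_def by blast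
  then show ?thesis by simp
qed

lemma B_Suc': "\<B> \<omega> (Suc n) = \<B> (\<sigma> \<omega>) n o\<^sub>L \<B> \<omega> 1"
proof -
  have "\<B> \<omega> (n + 1) = \<B> ((\<sigma> ^^ 1) \<omega>) n o\<^sub>L \<B> \<omega> 1"
    using cocycle' unfolding linear_cocycle_def by blast
  then show ?thesis by simp
qed

lemma B_0: "\<B> \<omega> 0 = id_blinfun"
  using cocycle' by (simp add: linear_cocycle_def)

text \<open>The forward orbit of \<open>v\<close>, extended by 0 to negative indices, is a bounded
  solution with jump \<open>v\<close> at index 0, hence equals the response.\<close>

lemma PB_bounded_forward:
  assumes \<omega>: "\<omega> \<in> \<Omega>" and b: "\<And>n. norm (\<B> \<omega> n v) \<le> b"
  shows "PB \<omega> v = v"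
proof -
  have b0: "0 \<le> b" using b[of 0] norm_ge_zero order_trans by blast
  let ?x = "\<lambda>m. if 0 \<le> m then \<B> \<omega> (nat m) v else 0"
  have "resp \<omega> v 0 = ?x 0"
  proof (rule resp_unique[OF \<omega>, where x = ?x])
    fix m :: int
    consider n where "m = int n" | "m = - 1" | "m < - 1"
      using nonneg_int_cases[of m] by fastforce
    then show "(if 0 \<le> m + 1 then \<B> \<omega> (nat (m + 1)) v else 0) =
        \<B> (orbit \<sigma> m \<omega>) 1 (if 0 \<le> m then \<B> \<omega> (nat m) v else 0) + (if m + 1 = 0 then v else 0)"
    proof cases
      case (1 n)
      then have "nat (m + 1) = Suc n" by simp
      then show ?thesis using 1 B_Suc[of \<omega> n] by simp
    qed (simp_all add: B_0)
    show "norm (if 0 \<le> m then \<B> \<omega> (nat m) v else 0) \<le> b"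
      using b b0 by simp
  qed
  then show ?thesis by (simp add: PB_apply[OF \<omega>] B_0)
qed

text \<open>The negative of the backward orbit, extended by 0 from index 0 onwards, is the response:
  with this sign the value \<open>- v\<close> arriving at index 0 is cancelled by the jump.\<close>

lemma PB_bounded_backward:
  assumes \<omega>: "\<omega> \<in> \<Omega>" and y0: "y 0 = v"
    and y: "\<And>n. \<B> ((inv \<sigma> ^^ Suc n) \<omega>) 1 (y (Suc n)) = y n" and b: "\<And>n. norm (y n) \<le> b"
  shows "PB \<omega> v = 0"
proof -
  have b0: "0 \<le> b" using b[of 0] norm_ge_zero order_trans by blast
  let ?x = "\<lambda>m. if 0 \<le> m then 0 else - y (nat (- m))"
  have "resp \<omega> v 0 = ?x 0"
  proof (rule resp_unique[OF \<omega>, where x = ?x])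
    fix m :: int
    show "(if 0 \<le> m + 1 then 0 else - y (nat (- (m + 1)))) =
        \<B> (orbit \<sigma> m \<omega>) 1 (if 0 \<le> m then 0 else - y (nat (- m))) + (if m + 1 = 0 then v else 0)"
    proof (cases "0 \<le> m")
      case False
      then obtain n where m: "m = - int (Suc n)" by (metis negD not_le)
      have "\<B> (orbit \<sigma> m \<omega>) 1 (y (Suc n)) = y n"
        unfolding m orbit_minus_int by (rule y)
      then show ?thesis using y0 by (auto simp: m nat_add_distrib blinfun.minus_right)
    qed simp
    show "norm (if 0 \<le> m then 0 else - y (nat (- m))) \<le> b"
      using b b0 by simp
  qed
  then show ?thesis by (simp add: PB_apply[OF \<omega>])
qed

lemma B_PB:
  assumes \<omega>: "\<omega> \<in> \<Omega>"
  shows "\<B> \<omega> n (PB \<omega> v) = resp \<omega> v (int n)"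
proof (induction n)
  case (Suc n)
  have "resp \<omega> v (int n + 1) = \<B> ((\<sigma> ^^ n) \<omega>) 1 (resp \<omega> v (int n))"
    using resp_recurrence[OF \<omega>, of v "int n"] by simp
  then show ?case by (simp add: B_Suc[of \<omega> n] Suc add.commute)
qed (simp add: PB_apply[OF \<omega>] B_0)

lemma norm_B_PB:
  assumes \<omega>: "\<omega> \<in> \<Omega>"
  shows "norm (\<B> \<omega> n o\<^sub>L PB \<omega>) \<le> K' \<omega> * exp (- \<beta>' * real n)"
proof (rule norm_blinfun_bound)
  show "0 \<le> K' \<omega> * exp (- \<beta>' * real n)" using K'_pos[of \<omega>] by simp
  fix v
  have "norm ((\<B> \<omega> n o\<^sub>L PB \<omega>) v) \<le> 2 * green_const \<beta> * K \<omega> * norm v * exp (- \<beta>' * real n)"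
    using norm_resp_le[OF \<omega>, of v "int n"] by (simp add: B_PB[OF \<omega>])
  also have "\<dots> \<le> K' \<omega> * norm v * exp (- \<beta>' * real n)"
    unfolding K'_def by (intro mult_right_mono) auto
  finally show "norm ((\<B> \<omega> n o\<^sub>L PB \<omega>) v) \<le> K' \<omega> * exp (- \<beta>' * real n) * norm v"
    by (simp add: mult_ac)
qed

lemma norm_B_PB_const:
  assumes \<omega>: "\<omega> \<in> \<Omega>"
  shows "norm (\<B> \<omega> n (PB \<omega> v)) \<le> K' \<omega> * norm v"
proof -
  have "norm (\<B> \<omega> n o\<^sub>L PB \<omega>) \<le> K' \<omega> * exp (- \<beta>' * real n)"
    by (rule norm_B_PB[OF \<omega>])
  also have "\<dots> \<le> K' \<omega> * 1"
    using K'_pos[of \<omega>] beta_pos by (intro mult_left_mono) (auto simp: \<beta>'_def)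
  finally have "norm (\<B> \<omega> n o\<^sub>L PB \<omega>) \<le> K' \<omega>" by simp
  then show ?thesis
    using norm_blinfun[of "\<B> \<omega> n o\<^sub>L PB \<omega>" v] mult_right_mono[OF _ norm_ge_zero[of v]]
    unfolding blinfun_apply_blinfun_compose by (blast intro: order_trans)
qed

lemma PB_PB: "\<omega> \<in> \<Omega> \<Longrightarrow> PB \<omega> (PB \<omega> v) = PB \<omega> v"
  by (rule PB_bounded_forward[OF _ norm_B_PB_const])

text \<open>The bounded backward orbit through \<open>v - PB \<omega> v\<close>.\<close>

definition bwd :: "'w \<Rightarrow> 'a \<Rightarrow> nat \<Rightarrow> 'a" where
  "bwd \<omega> v n = (if n = 0 then v - PB \<omega> v else - resp \<omega> v (- int n))"

lemma bwd_0: "bwd \<omega> v 0 = v - PB \<omega> v"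
  by (simp add: bwd_def)

text \<open>The separate value of \<open>bwd\<close> at 0 reflects the jump: the step into index 0
  sends the negated response to \<open>v - resp \<omega> v 0\<close>, not to
  \<open>- resp \<omega> v 0\<close>.\<close>

lemma B_bwd:
  assumes \<omega>: "\<omega> \<in> \<Omega>"
  shows "\<B> ((inv \<sigma> ^^ Suc n) \<omega>) 1 (bwd \<omega> v (Suc n)) = bwd \<omega> v n"
proof -
  have 1: "\<B> ((inv \<sigma> ^^ Suc n) \<omega>) 1 (resp \<omega> v (- int (Suc n))) + (if n = 0 then v else 0) = resp \<omega> v (- int n)"
    using resp_recurrence[OF \<omega>, of v "- int (Suc n)", unfolded orbit_minus_int] by simp
  have 2: "\<B> ((inv \<sigma> ^^ Suc n) \<omega>) 1 (bwd \<omega> v (Suc n)) = - \<B> ((inv \<sigma> ^^ Suc n) \<omega>) 1 (resp \<omega> v (- int (Suc n)))"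
    unfolding bwd_def by (simp only: blinfun.minus_right nat.distinct if_False)
  show ?thesis unfolding 2 using 1 by (auto simp: bwd_def PB_apply[OF \<omega>] algebra_simps)
qed

lemma norm_bwd_le:
  assumes \<omega>: "\<omega> \<in> \<Omega>"
  shows "norm (bwd \<omega> v n) \<le> K' \<omega> * exp (- \<beta>' * real n) * norm v"
proof (cases "n = 0")
  case True
  have "norm (bwd \<omega> v n) \<le> norm v + 2 * green_const \<beta> * K \<omega> * norm v"
    using norm_triangle_ineq4[of v "PB \<omega> v"] norm_resp_le[OF \<omega>, of v 0]
    by (simp add: True bwd_def PB_apply[OF \<omega>])
  then show ?thesis by (simp add: True K'_def algebra_simps)
next
  case False
  have "norm (bwd \<omega> v n) \<le> 2 * green_const \<beta> * K \<omega> * norm v * exp (- \<beta>' * real n)"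
    using norm_resp_le[OF \<omega>, of v "- int n"] False by (simp add: bwd_def)
  also have "\<dots> \<le> K' \<omega> * norm v * exp (- \<beta>' * real n)"
    unfolding K'_def by (intro mult_right_mono) auto
  finally show ?thesis by (simp add: mult_ac)
qed

lemma norm_bwd_le_const:
  assumes \<omega>: "\<omega> \<in> \<Omega>"
  shows "norm (bwd \<omega> v n) \<le> K' \<omega> * norm v"
proof -
  note norm_bwd_le[OF \<omega>, of v n]
  also have "K' \<omega> * exp (- \<beta>' * real n) * norm v \<le> K' \<omega> * 1 * norm v"
    using K'_pos[of \<omega>] beta_pos by (intro mult_left_mono mult_right_mono) (auto simp: \<beta>'_def)
  finally show ?thesis by simp
qed

text \<open>A tail of a bounded backward orbit is a bounded backward orbit of its first
  point.\<close>

lemma PB_bwd: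
  assumes \<omega>: "\<omega> \<in> \<Omega>"
  shows "PB ((inv \<sigma> ^^ n) \<omega>) (bwd \<omega> v n) = 0"
proof (rule PB_bounded_backward[OF funpow_inv_\<Omega>[OF \<omega>]])
  fix k
  show "\<B> ((inv \<sigma> ^^ Suc k) ((inv \<sigma> ^^ n) \<omega>)) 1 (bwd \<omega> v (n + Suc k)) = bwd \<omega> v (n + k)"
    using B_bwd[OF \<omega>, of "n + k" v] by (simp add: funpow_add[symmetric] add_ac flip: comp_apply[of "inv \<sigma> ^^ k"] funpow_add)
  show "norm (bwd \<omega> v (n + k)) \<le> K' \<omega> * norm v" by (rule norm_bwd_le_const[OF \<omega>])
qed simp

text \<open>Prepending \<open>\<B> \<omega> 1 v\<close> to the backward orbit through
  \<open>v\<close> keeps it bounded. The hypothesis \<open>PB \<omega> v = 0\<close> makes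
  \<open>bwd \<omega> v\<close> start at \<open>v\<close>.\<close>

lemma PB_step_backward:
  assumes \<omega>: "\<omega> \<in> \<Omega>" and "PB \<omega> v = 0"
  shows "PB (\<sigma> \<omega>) (\<B> \<omega> 1 v) = 0"
proof (rule PB_bounded_backward[OF step_\<Omega>[OF \<omega>]])
  let ?y = "\<lambda>n. case n of 0 \<Rightarrow> \<B> \<omega> 1 v | Suc k \<Rightarrow> bwd \<omega> v k"
  fix n
  show "\<B> ((inv \<sigma> ^^ Suc n) (\<sigma> \<omega>)) 1 (?y (Suc n)) = ?y n"
  proof (cases n)
    case 0
    then show ?thesis using assms(2) unfolding inv_step by (simp add: bwd_0)
  next
    case (Suc k)
    show ?thesis unfolding inv_step Suc using B_bwd[OF \<omega>, of k v] by (simp only: nat.case)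
  qed
  show "norm (?y n) \<le> max (norm (\<B> \<omega> 1 v)) (K' \<omega> * norm v)"
    using norm_bwd_le_const[OF \<omega>] by (auto split: nat.split simp: le_max_iff_disj)
qed simp

lemma PB_step_forward:
  assumes \<omega>: "\<omega> \<in> \<Omega>"
  shows "PB (\<sigma> \<omega>) (\<B> \<omega> 1 (PB \<omega> v)) = \<B> \<omega> 1 (PB \<omega> v)"
proof (rule PB_bounded_forward[OF step_\<Omega>[OF \<omega>]])
  fix n
  have "\<B> (\<sigma> \<omega>) n (\<B> \<omega> 1 (PB \<omega> v)) = \<B> \<omega> (Suc n) (PB \<omega> v)"
    unfolding B_Suc'[of \<omega> n] by simp
  then show "norm (\<B> (\<sigma> \<omega>) n (\<B> \<omega> 1 (PB \<omega> v))) \<le> K' \<omega> * norm v"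
    using norm_B_PB_const[OF \<omega>] by simp
qed

lemma PB_diff: "\<omega> \<in> \<Omega> \<Longrightarrow> PB \<omega> (v - PB \<omega> v) = 0"
  by (simp add: blinfun.diff_right PB_PB)

lemma PB_commute:
  assumes \<omega>: "\<omega> \<in> \<Omega>"
  shows "PB (\<sigma> \<omega>) o\<^sub>L \<B> \<omega> 1 = \<B> \<omega> 1 o\<^sub>L PB \<omega>"
proof (rule blinfun_eqI)
  fix v
  have "PB (\<sigma> \<omega>) (\<B> \<omega> 1 v) = PB (\<sigma> \<omega>) (\<B> \<omega> 1 (PB \<omega> v)) + PB (\<sigma> \<omega>) (\<B> \<omega> 1 (v - PB \<omega> v))"
    by (simp flip: blinfun.add_right)
  then show "(PB (\<sigma> \<omega>) o\<^sub>L \<B> \<omega> 1) v = (\<B> \<omega> 1 o\<^sub>L PB \<omega>) v"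
    using PB_step_backward[OF \<omega> PB_diff[OF \<omega>, of v]] PB_step_forward[OF \<omega>, of v] by simp
qed

text \<open>If two kernel vectors have the same image, their difference dies after one step; its
  forward orbit is bounded, so \<open>PB\<close> fixes it as well as annihilating it. Surjectivity
  is witnessed by the first backward step of \<open>bwd\<close>.\<close>

lemma PB_bij:
  assumes \<omega>: "\<omega> \<in> \<Omega>"
  shows "bij_betw (blinfun_apply (\<B> \<omega> 1)) (Ker (PB \<omega>)) (Ker (PB (\<sigma> \<omega>)))"
  unfolding bij_betw_def
proof
  show "inj_on (blinfun_apply (\<B> \<omega> 1)) (Ker (PB \<omega>))"
  proof (rule inj_onI)
    fix u v assume uv: "u \<in> Ker (PB \<omega>)" "v \<in> Ker (PB \<omega>)" "\<B> \<omega> 1 u = \<B> \<omega> 1 v"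
    have z: "\<B> \<omega> (Suc n) (u - v) = 0" for n
      unfolding B_Suc'[of \<omega> n] using uv(3) by (simp add: blinfun.diff_right)
    have "norm (\<B> \<omega> n (u - v)) \<le> norm (u - v)" for n
      by (cases n) (simp_all add: z B_0)
    from PB_bounded_forward[OF \<omega> this] have "PB \<omega> (u - v) = u - v" .
    then show "u = v" using uv(1,2) by (simp add: Ker_def blinfun.diff_right)
  qed
  show "blinfun_apply (\<B> \<omega> 1) ` Ker (PB \<omega>) = Ker (PB (\<sigma> \<omega>))"
  proof (intro equalityI subsetI)
    fix w assume w: "w \<in> Ker (PB (\<sigma> \<omega>))"
    note b = step_\<Omega>[OF \<omega>]
    have e: "(inv \<sigma> ^^ Suc 0) (\<sigma> \<omega>) = \<omega>" unfolding inv_step by simp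
    have "bwd (\<sigma> \<omega>) w 1 \<in> Ker (PB \<omega>)"
      using PB_bwd[OF b, of "Suc 0" w] unfolding e by (simp add: Ker_def)
    moreover have "\<B> \<omega> 1 (bwd (\<sigma> \<omega>) w 1) = w"
      using B_bwd[OF b, of 0 w] w unfolding e by (simp add: bwd_0 Ker_def)
    ultimately show "w \<in> blinfun_apply (\<B> \<omega> 1) ` Ker (PB \<omega>)" by (metis imageI)
  qed (auto simp: Ker_def PB_step_backward[OF \<omega>] simp del: One_nat_def)
qed

lemma backward_cocycle_PB:
  assumes \<omega>: "\<omega> \<in> \<Omega>"
  shows "backward_cocycle \<sigma> \<B> PB \<omega> n (v - PB \<omega> v) = bwd \<omega> v n"
proof -
  have "\<B> ((inv \<sigma> ^^ n) \<omega>) n (bwd \<omega> v n) = v - PB \<omega> v"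
  proof (induction n)
    case (Suc n)
    have "\<B> ((inv \<sigma> ^^ Suc n) \<omega>) (Suc n) (bwd \<omega> v (Suc n))
        = \<B> (\<sigma> ((inv \<sigma> ^^ Suc n) \<omega>)) n (\<B> ((inv \<sigma> ^^ Suc n) \<omega>) 1 (bwd \<omega> v (Suc n)))"
      unfolding B_Suc'[of _ n] blinfun_apply_blinfun_compose ..
    then show ?case unfolding step_inv_Suc B_bwd[OF \<omega>] Suc .
  qed (simp add: B_0 bwd_0)
  moreover have "inj_on (blinfun_apply (\<B> ((inv \<sigma> ^^ n) \<omega>) n)) (Ker (PB ((inv \<sigma> ^^ n) \<omega>)))"
    using bij_betw_cocycle[OF cocycle' \<Omega>_inv _ funpow_inv_\<Omega>[OF \<omega>], where P = PB] PB_bij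
    unfolding bij_betw_def by blast
  moreover have "bwd \<omega> v n \<in> Ker (PB ((inv \<sigma> ^^ n) \<omega>))"
    using PB_bwd[OF \<omega>] by (simp add: Ker_def)
  ultimately show ?thesis
    unfolding backward_cocycle_def by (metis the_inv_into_f_f)
qed

lemma bounded_linear_bwd:
  assumes \<omega>: "\<omega> \<in> \<Omega>"
  shows "bounded_linear (\<lambda>v. bwd \<omega> v n)"
proof (cases "n = 0")
  case True
  have "bounded_linear (\<lambda>v. v - PB \<omega> v)"
    by (rule bounded_linear_sub[OF bounded_linear_ident blinfun.bounded_linear_right])
  then show ?thesis by (simp add: bwd_def True)
next
  case False
  then show ?thesis
    using bounded_linear_minus[OF bounded_linear_resp[OF \<omega>, of "- int n"]] by (simp add: bwd_def)
qed

subsection \<open>Measurability of the projections\<close>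

abbreviation N :: "'w measure" where "N \<equiv> restrict_space M \<Omega>"

lemma space_N: "space N = \<Omega>"
  using \<Omega>_sets by (simp add: space_restrict_space space_UNIV)

lemma measurable_orbit_N: "orbit \<sigma> m \<in> measurable N N"
  by (rule measurable_restrict_space3[OF measurable_orbit]) (simp add: orbit_\<Omega>)

lemma measurable_N: "f \<in> measurable M L \<Longrightarrow> f \<in> measurable N L"
  by (rule measurable_restrict_space1)

text \<open>Only the generator is strongly measurable by definition; higher times are composed one
  step at a time.\<close>

lemma linear_cocycle_measurable:
  fixes \<C> :: "'w \<Rightarrow> nat \<Rightarrow> 'a \<Rightarrow>\<^sub>L 'a"
  assumes \<C>: "linear_cocycle M \<sigma> \<C>"
  shows "(\<lambda>\<omega>. \<C> \<omega> n x) \<in> borel_measurable M"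
proof (induction n)
  case 0
  then show ?case using \<C> by (simp add: linear_cocycle_def)
next
  case (Suc n)
  have "\<C> \<omega> (1 + n) = \<C> ((\<sigma> ^^ n) \<omega>) 1 o\<^sub>L \<C> \<omega> n" for \<omega>
    using \<C> unfolding linear_cocycle_def by blast
  then have e: "\<C> \<omega> (Suc n) x = \<C> ((\<sigma> ^^ n) \<omega>) 1 (\<C> \<omega> n x)" for \<omega>
    by simp
  have gen: "(\<lambda>\<omega>. \<C> \<omega> 1 y) \<in> borel_measurable M" for y
    using \<C> unfolding linear_cocycle_def by blast
  have "(\<lambda>\<omega>. \<C> ((\<sigma> ^^ n) \<omega>) 1 y) \<in> borel_measurable M" for y
    by (rule measurable_compose[OF _ gen]) (rule measurable_compose_n[OF measurable_base])
  from measurable_blinfun_compose[where T = "\<lambda>\<omega>. \<C> ((\<sigma> ^^ n) \<omega>) 1", OF this Suc]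
  show ?case unfolding e .
qed

lemma measurable_along:
  fixes T :: "'w \<Rightarrow> 'a \<Rightarrow>\<^sub>L 'a"
  assumes T: "\<And>x. (\<lambda>\<omega>. T \<omega> x) \<in> borel_measurable M" and \<tau>: "\<tau> \<in> measurable N N"
    and h: "h \<in> borel_measurable N"
  shows "(\<lambda>\<omega>. T (\<tau> \<omega>) (h \<omega>)) \<in> borel_measurable N"
proof (rule measurable_blinfun_compose[OF _ h])
  show "(\<lambda>\<omega>. T (\<tau> \<omega>) x) \<in> borel_measurable N" for x
    by (rule measurable_compose[OF \<tau> measurable_N[OF T]])
qed

text \<open>
  The inverse on the kernel is bounded, so near-preimages taken from a countable dense family of
  the kernel converge to the preimage; no measurable selection theorem is needed.
\<close>

lemma measurable_V:
  assumes \<tau>: "\<tau> \<in> measurable N N" and h: "h \<in> borel_measurable N"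
  shows "(\<lambda>\<omega>. V (\<tau> \<omega>) n (h \<omega>)) \<in> borel_measurable N"
proof -
  obtain d :: "nat \<Rightarrow> 'a" where d: "\<And>x e. e > 0 \<Longrightarrow> \<exists>i. dist (d i) x < e"
    using exists_dense_sequence by blast
  define S where "S \<omega> = orbit \<sigma> (- int n) (\<tau> \<omega>)" for \<omega>
  define T where "T \<omega> = \<A> (S \<omega>) n" for \<omega>
  \<comment> \<open>Projecting the dense sequence along \<open>P\<close> gives, at each base point,
    a sequence dense in the kernel there and measurable in \<omega>.\<close>
  define E where "E i \<omega> = d i - P (S \<omega>) (d i)" for i \<omega>
  define F where "F \<omega> = h \<omega> - P (\<tau> \<omega>) (h \<omega>)" for \<omega>
  \<comment> \<open>Taking the first admissible index makes the choice of a near-preimage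
    measurable.\<close>
  define a where "a j \<omega> = (LEAST i. norm (T \<omega> (E i \<omega>) - F \<omega>) < 1 / real (Suc j))" for j \<omega>
  have S: "S \<in> measurable N N"
    unfolding S_def by (rule measurable_compose[OF \<tau> measurable_orbit_N])
  have E: "E i \<in> borel_measurable N" for i
    unfolding E_def by (intro borel_measurable_diff borel_measurable_const measurable_along P_meas S)
  have F: "F \<in> borel_measurable N"
    unfolding F_def by (intro borel_measurable_diff measurable_along P_meas \<tau> h)
  have TE: "(\<lambda>\<omega>. T \<omega> (E i \<omega>)) \<in> borel_measurable N" for i
    unfolding T_def
    by (rule measurable_along[where T = "\<lambda>\<omega>. \<A> \<omega> n", OF linear_cocycle_measurable[OF cocycle] S E])
  have a: "a j \<in> measurable N (count_space UNIV)" for j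
    unfolding a_def
  proof (rule measurable_Least)
    fix i
    note [measurable] = TE F
    show "(\<lambda>\<omega>. norm (T \<omega> (E i \<omega>) - F \<omega>) < 1 / real (Suc j)) \<in> measurable N (count_space UNIV)"
      by measurable
  qed
  show ?thesis
  proof (rule borel_measurable_LIMSEQ_metric)
    show "(\<lambda>\<omega>. E (a j \<omega>) \<omega>) \<in> borel_measurable N" for j
      by (rule measurable_compose_countable[OF E a])
  next
    fix \<omega> assume "\<omega> \<in> space N"
    then have \<tau>\<omega>: "\<tau> \<omega> \<in> \<Omega>" using measurable_space[OF \<tau>] space_N by blast
    have S\<omega>: "S \<omega> = (inv \<sigma> ^^ n) (\<tau> \<omega>)" by (simp add: S_def)
    have S\<Omega>: "S \<omega> \<in> \<Omega>" unfolding S\<omega> by (rule funpow_inv_\<Omega>[OF \<tau>\<omega>])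
    define z where "z = V (\<tau> \<omega>) n (h \<omega>)"
    have zK: "P (S \<omega>) z = 0" using V_Ker[OF \<tau>\<omega>, of n "h \<omega>"] by (simp add: z_def S\<omega> Ker_def)
    have Tz: "T \<omega> z = F \<omega>" using A_V[OF \<tau>\<omega>, of n "h \<omega>"] by (simp add: z_def S\<omega> T_def F_def)
    have ex: "\<exists>i. norm (T \<omega> (E i \<omega>) - F \<omega>) < e" if "e > 0" for e
    proof -
      \<comment> \<open>Since \<open>z\<close> lies in the kernel, \<open>?L\<close> sends
        \<open>d i - z\<close> exactly to the image error; adding 1 to its norm avoids division by
        zero.\<close>
      let ?L = "T \<omega> o\<^sub>L (id_blinfun - P (S \<omega>))"
      obtain i where "dist (d i) z < e / (norm ?L + 1)"
        using d \<open>e > 0\<close> by (metis add_nonneg_pos divide_pos_pos norm_ge_zero zero_less_one)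
      then have i: "(norm ?L + 1) * norm (d i - z) < e"
        by (simp add: dist_norm pos_less_divide_eq add_nonneg_pos mult.commute)
      have "T \<omega> (E i \<omega>) - F \<omega> = ?L (d i - z)"
        by (simp add: E_def Tz[symmetric] blinfun.diff_right blinfun.diff_left zK)
      then have "norm (T \<omega> (E i \<omega>) - F \<omega>) \<le> norm ?L * norm (d i - z)"
        by (metis norm_blinfun)
      also have "\<dots> \<le> (norm ?L + 1) * norm (d i - z)" by (intro mult_right_mono) auto
      finally show ?thesis using i by (intro exI[of _ i]) linarith
    qed
    \<comment> \<open>\<open>V\<close> inverts \<open>T \<omega>\<close> on the kernel, so its norm
      bound turns a small image error into closeness to \<open>z\<close>.\<close>
    have le: "norm (E i \<omega> - z) \<le> K (\<tau> \<omega>) * exp (- \<beta> * real n) * norm (T \<omega> (E i \<omega>) - F \<omega>)" for i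
    proof -
      have K: "P (S \<omega>) (E i \<omega> - z) = 0"
        by (simp add: E_def blinfun.diff_right P_P zK)
      have "V (\<tau> \<omega>) n (T \<omega> (E i \<omega> - z)) = E i \<omega> - z"
        using V_A[OF S\<Omega>, of n "E i \<omega> - z"] unfolding K
        by (simp add: S\<omega> T_def funpow_cancel_inv[OF bij_base])
      then have "E i \<omega> - z = V (\<tau> \<omega>) n (T \<omega> (E i \<omega>) - F \<omega>)"
        by (simp add: blinfun.diff_right Tz)
      then show ?thesis using norm_V_le[OF \<tau>\<omega>] by metis
    qed
    show "(\<lambda>j. E (a j \<omega>) \<omega>) \<longlonglongrightarrow> V (\<tau> \<omega>) n (h \<omega>)"
      unfolding z_def[symmetric]
    proof (rule LIM_zero_cancel, rule Lim_null_comparison)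
      show "(\<lambda>j. K (\<tau> \<omega>) * exp (- \<beta> * real n) * (1 / real (Suc j))) \<longlonglongrightarrow> 0"
        by (rule tendsto_mult_right_zero) (rule LIMSEQ_Suc[OF lim_1_over_n])
      have "norm (T \<omega> (E (a j \<omega>) \<omega>) - F \<omega>) \<le> 1 / real (Suc j)" for j
        unfolding a_def using LeastI_ex[OF ex[of "1 / real (Suc j)"]] by simp
      then have "norm (E (a j \<omega>) \<omega> - z) \<le> K (\<tau> \<omega>) * exp (- \<beta> * real n) * (1 / real (Suc j))" for j
        by (intro order_trans[OF le] mult_left_mono) (auto simp: less_imp_le[OF K_pos])
      then show "\<forall>\<^sub>F j in sequentially. norm (E (a j \<omega>) \<omega> - z) \<le> K (\<tau> \<omega>) * exp (- \<beta> * real n) * (1 / real (Suc j))"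
        by simp
    qed
  qed
qed

text \<open>This is the use of an explicit iteration: each step involves only countable sums of the
  cocycles, \<open>P\<close> and \<open>V\<close> applied along the orbit to measurable
  functions.\<close>

lemma measurable_iterates: "(\<lambda>\<omega>. iterates \<omega> v j m) \<in> borel_measurable N"
proof (induction j arbitrary: m)
  case 0
  have "(\<lambda>\<omega>. iterates \<omega> v 0 m) \<in> borel_measurable N \<longleftrightarrow> (\<lambda>\<omega>. 0 :: 'a) \<in> borel_measurable N"
    by (rule measurable_cong) (simp add: space_N iterates_0)
  then show ?case by simp
next
  case (Suc j)
  define g where "g \<omega> n = (\<B> (orbit \<sigma> (n - 1) \<omega>) 1 - \<A> (orbit \<sigma> (n - 1) \<omega>) 1) (iterates \<omega> v j (n - 1))
      + (if n = 0 then v else 0)" for \<omega> n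
  have gm: "(\<lambda>\<omega>. g \<omega> n) \<in> borel_measurable N" for n
    unfolding g_def blinfun.diff_left
    by (intro borel_measurable_add borel_measurable_diff borel_measurable_const Suc
        measurable_along[where T = "\<lambda>\<omega>. \<B> \<omega> 1"] measurable_along[where T = "\<lambda>\<omega>. \<A> \<omega> 1"]
        measurable_orbit_N linear_cocycle_measurable[OF cocycle] linear_cocycle_measurable[OF cocycle'])
  have s: "(\<lambda>\<omega>. \<A> (orbit \<sigma> (m - int j) \<omega>) j (P (orbit \<sigma> (m - int j) \<omega>) (g \<omega> (m - int j)))) \<in> borel_measurable N" for j
    by (intro measurable_along[where T = "\<lambda>\<omega>. \<A> \<omega> j"] measurable_along[where T = P] P_meas
        linear_cocycle_measurable[OF cocycle] measurable_orbit_N gm)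
  have u: "(\<lambda>\<omega>. V (orbit \<sigma> (m + int j + 1) \<omega>) (Suc j) (g \<omega> (m + int j + 1))) \<in> borel_measurable N" for j
    by (intro measurable_V measurable_orbit_N gm)
  have "(\<lambda>\<omega>. iterates \<omega> v (Suc j) m) \<in> borel_measurable N \<longleftrightarrow>
     (\<lambda>\<omega>. (\<Sum>j. \<A> (orbit \<sigma> (m - int j) \<omega>) j (P (orbit \<sigma> (m - int j) \<omega>) (g \<omega> (m - int j))))
       - (\<Sum>j. V (orbit \<sigma> (m + int j + 1) \<omega>) (Suc j) (g \<omega> (m + int j + 1)))) \<in> borel_measurable N"
    by (rule measurable_cong) (simp only: space_N iterates_Suc g_def Let_def)
  also have "\<dots>"
    by (intro borel_measurable_diff borel_measurable_suminf s u)
  finally show ?case .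
qed

lemma measurable_PB: "(\<lambda>\<omega>. PB \<omega> v) \<in> borel_measurable M"
proof -
  have "(\<lambda>\<omega>. resp \<omega> v 0) \<in> borel_measurable N \<longleftrightarrow>
      (\<lambda>\<omega>. lim (\<lambda>j. iterates \<omega> v j 0)) \<in> borel_measurable N"
    by (rule measurable_cong) (simp add: space_N resp_eq_lim)
  also have "\<dots>" by (intro borel_measurable_lim_metric measurable_iterates)
  finally have r: "(\<lambda>\<omega>. resp \<omega> v 0) \<in> borel_measurable N" .
  have "(\<lambda>\<omega>. if \<omega> \<in> \<Omega> then resp \<omega> v 0 else 0) \<in> borel_measurable M"
    using r \<Omega>_sets by (subst measurable_restrict_space_iff[symmetric]) (auto simp: space_UNIV)
  moreover have "PB \<omega> v = (if \<omega> \<in> \<Omega> then resp \<omega> v 0 else 0)" for \<omega>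
    using PB_apply[of \<omega> v] by (simp add: PB_def)
  ultimately show ?thesis by simp
qed

lemma dichotomy_perturbed: "tempered_exponential_dichotomy M \<sigma> \<B>"
  unfolding tempered_exponential_dichotomy_def
proof (intro exI conjI ballI allI)
  show "\<Omega> \<in> sets M" "measure M \<Omega> = 1" "\<sigma> -` \<Omega> = \<Omega>"
    by (fact \<Omega>_sets \<Omega>_prob \<Omega>_inv)+
  show "tempered M \<sigma> K'"
    unfolding K'_def using tempered_affine[OF K_tempered, of "2 * green_const \<beta>"] green_pos by simp
  show "\<beta>' > 0" using beta_pos by (simp add: \<beta>'_def)
  show "PB \<omega> o\<^sub>L PB \<omega> = PB \<omega>" for \<omega>
    by (cases "\<omega> \<in> \<Omega>") (auto intro!: blinfun_eqI simp: PB_PB, simp add: PB_def)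
  show "(\<lambda>\<omega>. PB \<omega> v) \<in> borel_measurable M" for v by (rule measurable_PB)
  fix \<omega> assume \<omega>: "\<omega> \<in> \<Omega>"
  show "PB (\<sigma> \<omega>) o\<^sub>L \<B> \<omega> 1 = \<B> \<omega> 1 o\<^sub>L PB \<omega>" by (rule PB_commute[OF \<omega>])
  show "bij_betw (blinfun_apply (\<B> \<omega> 1)) (Ker (PB \<omega>)) (Ker (PB (\<sigma> \<omega>)))" by (rule PB_bij[OF \<omega>])
  fix n
  show "norm (\<B> \<omega> n o\<^sub>L PB \<omega>) \<le> K' \<omega> * exp (- \<beta>' * real n)" by (rule norm_B_PB[OF \<omega>])
  show "bounded_linear (\<lambda>x. backward_cocycle \<sigma> \<B> PB \<omega> n (x - PB \<omega> x))"
    unfolding backward_cocycle_PB[OF \<omega>] by (rule bounded_linear_bwd[OF \<omega>])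
  show "onorm (\<lambda>x. backward_cocycle \<sigma> \<B> PB \<omega> n (x - PB \<omega> x)) \<le> K' \<omega> * exp (- \<beta>' * real n)"
    unfolding backward_cocycle_PB[OF \<omega>] by (intro onorm_bound norm_bwd_le \<omega>) (simp add: less_imp_le[OF K'_pos])
qed

end

section \<open>Choice of the closeness function and of the invariant set\<close>

theorem theorem20:
  fixes M :: "'w::polish_space measure"
    and \<sigma> :: "'w \<Rightarrow> 'w"
    and \<A> :: "'w \<Rightarrow> nat \<Rightarrow> ('a::{banach, second_countable_topology} \<Rightarrow>\<^sub>L 'a)"
  assumes "aperiodic_ergodic_system M \<sigma>"
    and "linear_cocycle M \<sigma> \<A>"
    and "tempered_exponential_dichotomy M \<sigma> \<A>"
  shows "\<exists>c :: 'w \<Rightarrow> real. tempered M \<sigma> c \<and>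
    (\<forall>\<B> :: 'w \<Rightarrow> nat \<Rightarrow> ('a \<Rightarrow>\<^sub>L 'a).
       linear_cocycle M \<sigma> \<B> \<longrightarrow> compact_cocycle \<B> \<longrightarrow>
       (AE \<omega> in M. norm (\<A> \<omega> 1 - \<B> \<omega> 1) \<le> c \<omega>) \<longrightarrow>
       tempered_exponential_dichotomy M \<sigma> \<B>)"
proof -
  interpret aperiodic_ergodic_system M \<sigma> by (rule assms(1))
  obtain \<Omega>' K \<beta> P where \<Omega>': "\<Omega>' \<in> sets M" "prob \<Omega>' = 1"
    and K: "tempered M \<sigma> K" and \<beta>: "\<beta> > 0"
    and P: "\<And>\<omega>. P \<omega> o\<^sub>L P \<omega> = P \<omega>" "\<And>v. (\<lambda>\<omega>. P \<omega> v) \<in> borel_measurable M"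
    and dich: "\<And>\<omega>. \<omega> \<in> \<Omega>' \<Longrightarrow> P (\<sigma> \<omega>) o\<^sub>L \<A> \<omega> 1 = \<A> \<omega> 1 o\<^sub>L P \<omega>"
      "\<And>\<omega>. \<omega> \<in> \<Omega>' \<Longrightarrow> bij_betw (blinfun_apply (\<A> \<omega> 1)) (Ker (P \<omega>)) (Ker (P (\<sigma> \<omega>)))"
      "\<And>\<omega> n. \<omega> \<in> \<Omega>' \<Longrightarrow> norm (\<A> \<omega> n o\<^sub>L P \<omega>) \<le> K \<omega> * exp (- \<beta> * real n)"
      "\<And>\<omega> n. \<omega> \<in> \<Omega>' \<Longrightarrow> bounded_linear (\<lambda>x. backward_cocycle \<sigma> \<A> P \<omega> n (x - P \<omega> x))"
      "\<And>\<omega> n. \<omega> \<in> \<Omega>' \<Longrightarrow> onorm (\<lambda>x. backward_cocycle \<sigma> \<A> P \<omega> n (x - P \<omega> x)) \<le> K \<omega> * exp (- \<beta> * real n)"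
    using assms(3) unfolding tempered_exponential_dichotomy_def
  proof (elim exE conjE, goal_cases)
    case (1 \<Omega>' K \<beta> P)
    show ?case by (rule 1(1)[of \<Omega>' K \<beta> P]) (use 1(2-) in blast)+
  qed
  \<comment> \<open>Depends on \<beta> alone, so the closeness function below is fixed before \<B>
    is given.\<close>
  define \<delta> where "\<delta> = exp (- \<beta> / 2) / (2 * green_const \<beta>)"
  have \<delta>: "\<delta> > 0" using green_const_pos[OF \<beta>] by (simp add: \<delta>_def)
  have Kpos: "K \<omega> > 0" for \<omega> using K by (simp add: tempered_iff)
  show ?thesis
  proof (intro exI conjI allI impI)
    show "tempered M \<sigma> (\<lambda>\<omega>. \<delta> / K (\<sigma> \<omega>))" by (rule tempered_inverse_shift[OF K \<delta>])
    fix \<B> :: "'w \<Rightarrow> nat \<Rightarrow> ('a \<Rightarrow>\<^sub>L 'a)"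
    assume \<B>: "linear_cocycle M \<sigma> \<B>" and c: "AE \<omega> in M. norm (\<A> \<omega> 1 - \<B> \<omega> 1) \<le> \<delta> / K (\<sigma> \<omega>)"
    have "AE \<omega> in M. \<omega> \<in> \<Omega>'" using \<Omega>' by (simp add: AE_in_set_eq_1)
    moreover have "AE \<omega> in M. tempered_at \<sigma> K \<omega>" using K by (simp add: tempered_iff)
    ultimately have "AE \<omega> in M. \<omega> \<in> \<Omega>' \<and> tempered_at \<sigma> K \<omega> \<and> norm (\<A> \<omega> 1 - \<B> \<omega> 1) \<le> \<delta> / K (\<sigma> \<omega>)"
      using c by (simp only: AE_conj_iff)
    \<comment> \<open>Unlike the closeness function, this set may depend on \<B>, since closeness
      holds only off a null set depending on \<B>.\<close>
    then obtain \<Omega> where \<Omega>: "\<Omega> \<in> sets M" "prob \<Omega> = 1" "\<sigma> -` \<Omega> = \<Omega>"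
      and good: "\<And>\<omega>. \<omega> \<in> \<Omega> \<Longrightarrow> \<omega> \<in> \<Omega>' \<and> tempered_at \<sigma> K \<omega> \<and> norm (\<A> \<omega> 1 - \<B> \<omega> 1) \<le> \<delta> / K (\<sigma> \<omega>)"
      using AE_invariant_set by blast
    interpret perturbed_cocycle M \<sigma> \<A> \<B> \<Omega> K \<beta> P
    proof (intro perturbed_cocycle.intro perturbed_cocycle_axioms.intro)
      fix \<omega> n
      assume \<omega>: "\<omega> \<in> \<Omega>"
      show "tempered_at \<sigma> K \<omega>" using good[OF \<omega>] by blast
      note \<omega>' = conjunct1[OF good[OF \<omega>]]
      show "P (\<sigma> \<omega>) o\<^sub>L \<A> \<omega> 1 = \<A> \<omega> 1 o\<^sub>L P \<omega>" by (rule dich[OF \<omega>'])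
      show "bij_betw (blinfun_apply (\<A> \<omega> 1)) (Ker (P \<omega>)) (Ker (P (\<sigma> \<omega>)))" by (rule dich[OF \<omega>'])
      show "norm (\<A> \<omega> n o\<^sub>L P \<omega>) \<le> K \<omega> * exp (- \<beta> * real n)" by (rule dich[OF \<omega>'])
      show "bounded_linear (\<lambda>x. backward_cocycle \<sigma> \<A> P \<omega> n (x - P \<omega> x))" by (rule dich[OF \<omega>'])
      show "onorm (\<lambda>x. backward_cocycle \<sigma> \<A> P \<omega> n (x - P \<omega> x)) \<le> K \<omega> * exp (- \<beta> * real n)" by (rule dich[OF \<omega>'])
      have "norm (\<A> \<omega> 1 - \<B> \<omega> 1) \<le> \<delta> / K (\<sigma> \<omega>)" using good[OF \<omega>] by blast
      then show "K (\<sigma> \<omega>) * norm (\<A> \<omega> 1 - \<B> \<omega> 1) \<le> exp (- \<beta> / 2) / (2 * green_const \<beta>)"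
        using Kpos[of "\<sigma> \<omega>"] unfolding \<delta>_def[symmetric] by (simp only: pos_le_divide_eq mult.commute)
    qed (fact assms(1,2) \<B> \<Omega> K \<beta> P)+
    show "tempered_exponential_dichotomy M \<sigma> \<B>" by (rule dichotomy_perturbed)
  qed
qed

end
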